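(* Let $n\ge 5$. Let $S$ be an $(n-2)$-dimensional $\mathbb{F}_q$-subspace of $\mathbb{F}_{q^n}$ with $1\in S$, let $a\in\mathbb{F}_{q^n}\setminus S$, $b\in\mathbb{F}_{q^n}\setminus\mathbb{F}_q$, and $U=(S\times\{0\})\oplus\langle(1,1)\rangle_{\mathbb{F}_q}\oplus\langle(a,b)\rangle_{\mathbb{F}_q}\subseteq\mathbb{F}_{q^n}^2$. Let $T=\langle 1,b\rangle_{\mathbb{F}_q}$ and let $t$ be such that $\mathbb{F}_q(b)=\mathbb{F}_{q^t}$. Then exactly one of the following three cases occurs: (1) $\dim_{\mathbb{F}_q}\langle S\cdot T\rangle_{\mathbb{F}_q}=n$; then $L_U$ is not an $(n-2)$-club, $L_U$ contains $q^{n-4}$ points of weight $2$, and $|L_U|=q^{n-1}+q^{n-2}-q^{n-3}+1$. (2) $\dim_{\mathbb{F}_q}\langle S\cdot T\rangle_{\mathbb{F}_q}=n-1$; then $L_U$ is an $(n-2)$-club (of rank $n$) if and only if $a\notin\langle S\cdot T\rangle_{\mathbb{F}_q}$. If $a\in\langle S\cdot T\rangle_{\mathbb{F}_q}$, then $L_U$ has $q^{n-3}$ points of weight $2$ and $|L_U|=q^{n-1}+1$. If $a\notin\langle S\cdot T\rangle_{\mathbb{F}_q}$, then: (2.1) if $t\ge n-2$, then $t=n$ and there exists $c\in\mathbb{F}_{q^n}^*$ with $S=c\langle 1,b,\ldots,b^{n-3}\rangle_{\mathbb{F}_q}$, so that $L_U=\{\langle(\sum_{i=0}^{n-3}cx_ib^i+\alpha+\beta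 a,\ \alpha+\beta b)\rangle_{\mathbb{F}_{q^n}} : x_i,\alpha,\beta\in\mathbb{F}_q\text{ not all zero}\}$; (2.2) if $t\le n-3$, then $t\ge 3$ and there exist a nonnegative integer $\ell$ with $n=t(\ell+1)$, an element $c\in\mathbb{F}_{q^n}^*$ and an $\mathbb{F}_{q^t}$-subspace $\overline{S}$ of $\mathbb{F}_{q^n}$ of $\mathbb{F}_{q^t}$-dimension $\ell$ with $c\mathbb{F}_{q^t}\cap\overline{S}=\{0\}$ such that $S=\overline{S}\oplus c\langle 1,b,\ldots,b^{t-3}\rangle_{\mathbb{F}_q}$, so that $L_U=\{\langle(\overline{s}+\sum_{i=0}^{t-3}cx_ib^i+\alpha+\beta a,\ \alpha+\beta b)\rangle_{\mathbb{F}_{q^n}} : x_i,\alpha,\beta\in\mathbb{F}_q,\ \overline{s}\in\overline{S}\text{ not all zero}\}$. (3) $\dim_{\mathbb{F}_q}\langle S\cdot T\rangle_{\mathbb{F}_q}=n-2$; then $n$ is even, $\mathbb{F}_q(b)=\mathbb{F}_{q^2}$, $S$ is an $\mathbb{F}_{q^2}$-subspace, and there exist $c\in\mathbb{F}_{q^n}^*$ and $\gamma\in\mathbb{F}_{q^n}^*$ with $\mathbb{F}_{q^2}(\gamma)=\mathbb{F}_{q^n}$ such that $S=c\langle 1,\gamma,\ldots,\gamma^{n/2-2}\rangle_{\mathbb{F}_{q^2}}$, so that $L_U=\{\langle(\sum_{i=0}^{n/2-2}cx_i\gamma^i+\alpha+\beta a,\ \alpha+\beta b)\rangle_{\mathbb{F}_{q^n}}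 : x_i\in\mathbb{F}_{q^2},\ \alpha,\beta\in\mathbb{F}_q\text{ not all zero}\}$. Moreover $L_U$ is an $(n-2)$-club of rank $n$ if and only if $a\notin c\langle 1,\gamma,\ldots,\gamma^{n/2-2}\rangle_{\mathbb{F}_{q^2}}$; if $a\in c\langle 1,\gamma,\ldots,\gamma^{n/2-2}\rangle_{\mathbb{F}_{q^2}}$, then all points of $L_U$ different from $\langle(1,0)\rangle_{\mathbb{F}_{q^n}}$ have weight $2$ and $|L_U|=q^{n-2}+1$. In particular, if $n$ is prime, Cases (2.2) and (3) cannot occur.
   Context: $q$ is a prime power. For an $\mathbb{F}_q$-subspace $U$ of $\mathbb{F}_{q^n}^2$, $L_U=\{\langle u\rangle_{\mathbb{F}_{q^n}}: u\in U\setminus\{0\}\}\subseteq\mathrm{PG}(1,q^n)$ is an $\mathbb{F}_q$-linear set of rank $\dim_{\mathbb{F}_q}U$; the weight of $P=\langle v\rangle_{\mathbb{F}_{q^n}}$ is $w_{L_U}(P)=\dim_{\mathbb{F}_q}(U\cap\langle v\rangle_{\mathbb{F}_{q^n}})$. An $(n-2)$-club is an $\mathbb{F}_q$-linear set of rank $n$ in $\mathrm{PG}(1,q^n)$ in which exactly one point has weight $n-2$ and all other points have weight $1$. $\langle S\cdot T\rangle_{\mathbb{F}_q}$ is the $\mathbb{F}_q$-span of all products $st$ with $s\in S$, $t\in T$. *)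

theory Defs
  imports "HOL-Algebra.Algebra" "HOL-Computational_Algebra.Primes"
begin

text \<open>
  For a field \<open>R\<close>, the space \<open>R\<^sup>2\<close> is the additive group of the product ring \<open>R \<times> R\<close>. A subfield
  \<open>K\<close> of \<open>R\<close> acts on it by scalars: \<open>k (x, y) = (k x, k y) = (k, k) (x, y)\<close>. So \<open>K\<close>-linear algebra
  in \<open>R\<^sup>2\<close> is the linear algebra of the ring \<open>R \<times> R\<close> over its subfield \<open>{(k, k) | k \<in> K}\<close>.
\<close>

abbreviation plane :: "('a, 'm) ring_scheme \<Rightarrow> ('a \<times> 'a) ring"
  where "plane R \<equiv> RDirProd R R"

definition diag :: "'a set \<Rightarrow> ('a \<times> 'a) set"
  where "diag K = (\<lambda>k. (k, k)) ` K"

lemma (in ring) diag_hom: "ring_hom_ring R (plane R) (\<lambda>k. (k, k))"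
proof (rule ring_hom_ringI2)
  show "ring R" by (rule ring_axioms)
  show "ring (plane R)" by (rule RDirProd_ring[OF ring_axioms ring_axioms])
  show "(\<lambda>k. (k, k)) \<in> ring_hom R (plane R)"
    by (rule ring_hom_memI) (simp_all add: RDirProd_def DirProd_def monoid.defs)
qed

lemma (in field) plane_one_not_zero: "\<one>\<^bsub>plane R\<^esub> \<noteq> \<zero>\<^bsub>plane R\<^esub>"
  using one_not_zero unfolding RDirProd_def DirProd_def monoid.defs
  by (metis fst_conv monoid.select_convs(2) ring.select_convs(1))

lemma (in field) diag_subfield:
  assumes "subfield K R"
  shows "subfield (diag K) (plane R)"
  unfolding diag_def
  by (rule ring_hom_ring.img_is_subfield(2)[OF diag_hom assms plane_one_not_zero])

definition span_set :: "('a, 'm) ring_scheme \<Rightarrow> 'a set \<Rightarrow> 'a set \<Rightarrow> 'a set"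
  where "span_set R K A = \<Inter> {V. subalgebra K V R \<and> A \<subseteq> V}"

definition proj_point :: "('a, 'm) ring_scheme \<Rightarrow> 'a \<times> 'a \<Rightarrow> ('a \<times> 'a) set"
  where "proj_point R v = {(x \<otimes>\<^bsub>R\<^esub> fst v, x \<otimes>\<^bsub>R\<^esub> snd v) | x. x \<in> carrier R}"

definition linear_set :: "('a, 'm) ring_scheme \<Rightarrow> ('a \<times> 'a) set \<Rightarrow> ('a \<times> 'a) set set"
  where "linear_set R U = proj_point R ` (U - {\<zero>\<^bsub>plane R\<^esub>})"

definition weight :: "('a, 'm) ring_scheme \<Rightarrow> 'a set \<Rightarrow> ('a \<times> 'a) set \<Rightarrow> ('a \<times> 'a) set \<Rightarrow> nat"
  where "weight R K U P = (ring.dim (plane R) over diag K) (U \<inter> P)"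

text \<open>The linear set of \<open>U\<close> is an \<open>i\<close>-club of rank \<open>k\<close>; rank and weights depend on \<open>U\<close>, not only
  on the point set.\<close>

definition club :: "('a, 'm) ring_scheme \<Rightarrow> 'a set \<Rightarrow> nat \<Rightarrow> nat \<Rightarrow> ('a \<times> 'a) set \<Rightarrow> bool"
  where "club R K k i U \<longleftrightarrow>
    ring.dimension (plane R) k (diag K) U \<and>
    (\<exists>!P. P \<in> linear_set R U \<and> weight R K U P = i) \<and>
    (\<forall>P \<in> linear_set R U. weight R K U P \<noteq> i \<longrightarrow> weight R K U P = 1)"

end

theory Submission
  imports Defs
begin

text \<open>
  In the finite setting a subspace is measured by its cardinality. The second coordinates
  of \<open>U\<close> lie in the plane \<open>T\<close>, so the points other than \<open>\<langle>(1, 0)\<rangle>\<close> have weight at most 2, and \<open>\<langle>(x, 1)\<rangle>\<close> has weight 2 iff \<open>x \<in> S\<close> and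
  \<open>b x - a \<in> S\<close>. Such an \<open>x\<close> exists iff \<open>a \<in> S + b S = \<langle>S T\<rangle>\<close>, and then the solutions form a coset
  of \<open>D S = {x \<in> S. b x \<in> S}\<close>, whose size is \<open>|S|\<^sup>2 / |S + b S|\<close>; counting the vectors of \<open>U\<close> gives
  \<open>|L\<^sub>U|\<close>.

  If \<open>S + b S\<close> is a hyperplane, then \<open>D S\<close> has codimension 1 in \<open>S\<close>, and in the chain
  \<open>S, D S, D (D S), \<dots>\<close> every step has codimension at most 1. The chain ends in the largest
  \<open>K(b)\<close>-subspace \<open>S'\<close> of \<open>S\<close>. A vector \<open>c\<close> of the last term above \<open>S'\<close> satisfies
  \<open>c, c b, \<dots>, c b\<^sup>m\<^sup>-\<^sup>1 \<in> S\<close>, where \<open>m\<close> is the length of the chain, so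
  \<open>S = S' \<oplus> c \<langle>1, \<dots>, b\<^sup>m\<^sup>-\<^sup>1\<rangle>\<close> by dimension, and divisibility by \<open>t\<close> forces \<open>m = t - 2\<close>. If \<open>S\<close> is
  stable under \<open>b\<close>, then \<open>t\<close> divides \<open>n\<close> and \<open>n - 2\<close>, so \<open>t = 2\<close>, and the same decomposition over
  \<open>K(b)\<close>, for a generator \<open>\<gamma>\<close> of the multiplicative group in place of \<open>b\<close>, has \<open>S' = 0\<close>.
\<close>

section \<open>Subspaces of a finite ring and their cardinalities\<close>

context ring
begin

text \<open>Each step of the inductive definition of dimension adjoins a vector \<open>v\<close>
  outside \<open>E\<close>. The resulting line extension is a bijective image of
  \<open>K \<times> E\<close>, so the cardinality is multiplied by \<open>card K\<close>.\<close>

lemma card_dimension: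
  assumes "subfield K R" "finite K" "dimension k K V"
  shows "finite V \<and> card V = card K ^ k"
  using assms(3,1,2)
proof (induction rule: dimension.induct)
  case (zero_dim K)
  show ?case by simp
next
  case (Suc_dim v E n K)
  note K = \<open>subfield K R\<close>
  have IH: "finite E" "card E = card K ^ n" using Suc_dim by auto
  note E = space_subgroup_props[OF K \<open>dimension n K E\<close>]
  have Kc: "K \<subseteq> carrier R" using subfieldE(3)[OF K] .
  have img: "line_extension K v E = (\<lambda>(k, e). k \<otimes> v \<oplus> e) ` (K \<times> E)"
    unfolding set_eq_iff line_extension_mem_iff image_iff by (simp add: Bex_def)
  have "inj_on (\<lambda>(k, e). k \<otimes> v \<oplus> e) (K \<times> E)"
  proof (rule inj_onI, clarify)
    fix k e k' e'
    assume A: "k \<in> K" "e \<in> E" "k' \<in> K" "e' \<in> E" and eq: "k \<otimes> v \<oplus> e = k' \<otimes> v \<oplus> e'"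
    have c: "k \<in> carrier R" "k' \<in> carrier R" "e \<in> carrier R" "e' \<in> carrier R"
      using A Kc E(1) by auto
    have "(k \<ominus> k') \<otimes> v = (k \<otimes> v \<oplus> e) \<ominus> (k' \<otimes> v) \<ominus> e"
      using c \<open>v \<in> carrier R\<close> by algebra
    also have "\<dots> = e' \<ominus> e"
      unfolding eq using c \<open>v \<in> carrier R\<close> by algebra
    finally have d: "(k \<ominus> k') \<otimes> v = e' \<ominus> e" .
    moreover have "e' \<ominus> e \<in> E"
      unfolding a_minus_def using A E(3,4) by blast
    moreover have "k \<ominus> k' \<in> K"
      unfolding a_minus_def using A subringE(5,7)[OF subfieldE(1)[OF K]] by blast
    \<comment> \<open>A nonzero scalar could be divided out, which would put \<open>v\<close> into
      \<open>E\<close>.\<close>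
    ultimately have "k \<ominus> k' = \<zero>"
      using E(6)[of "k \<ominus> k'" v] Suc_dim(1,2) by auto
    hence "k = k'" using c by simp
    moreover have "e = e'" using eq \<open>k = k'\<close> c Suc_dim(1) by simp
    ultimately show "k = k' \<and> e = e'" by simp
  qed
  hence "card (line_extension K v E) = card K * card E"
    unfolding img by (simp add: card_image card_cartesian_product)
  thus ?case using IH img \<open>finite K\<close> by simp
qed

lemma subfield_card_ge_2:
  assumes "subfield K R" "finite K"
  shows "card K \<ge> 2"
proof -
  have "{\<zero>, \<one>} \<subseteq> K" "\<one> \<noteq> \<zero>"
    using subringE(2,3)[OF subfieldE(1)[OF assms(1)]] subfieldE(6)[OF assms(1)] by auto
  thus ?thesis using card_mono[OF assms(2), of "{\<zero>, \<one>}"] by simp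
qed

text \<open>A list of all ring elements spans a finite-dimensional space that contains
  \<open>V\<close>.\<close>

lemma subalgebra_imp_dimension:
  assumes "finite (carrier R)" "subfield K R" "subalgebra K V R"
  shows "\<exists>k. dimension k K V"
proof -
  obtain xs where xs: "set xs = carrier R" using finite_list[OF assms(1)] by blast
  have "finite_dimension K (Span K xs)" using Span_finite_dimension[OF assms(2)] xs by simp
  moreover have "V \<subseteq> Span K xs"
    using Span_base_incl[OF assms(2), of xs] xs subalgebra_in_carrier[OF assms(3)] by auto
  ultimately show ?thesis
    using subalbegra_incl_imp_finite_dimension[OF assms(2) _ assms(3)] by (auto simp: finite_dimension_def)
qed

text \<open>Since \<open>card K\<close> exceeds 1, the size of a subspace determines its exponent.
  This bridge lets the later arguments count elements instead of handling bases.\<close>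

lemma dimension_iff_card:
  assumes "finite (carrier R)" "subfield K R"
  shows "dimension k K V \<longleftrightarrow> subalgebra K V R \<and> card V = card K ^ k"
proof -
  have fK: "finite K" using finite_subset[OF subfieldE(3)[OF assms(2)] assms(1)] .
  have "1 < card K" using subfield_card_ge_2[OF assms(2) fK] by simp
  hence inj: "card K ^ i = card K ^ j \<Longrightarrow> i = j" for i j by (simp add: power_inject_exp)
  show ?thesis
    using card_dimension[OF assms(2) fK] finite_dimension_imp_subalgebra[OF assms(2)]
      finite_dimensionI subalgebra_imp_dimension[OF assms] inj by metis
qed

lemma set_add_mem_iff: "x \<in> A <+>\<^bsub>R\<^esub> B \<longleftrightarrow> (\<exists>a \<in> A. \<exists>b \<in> B. x = a \<oplus> b)"
  unfolding set_add_def' by auto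

text \<open>Additive inverses come for free, as multiples by the scalar
  \<open>\<ominus> \<one>\<close>.\<close>

lemma subalgebraI:
  assumes "V \<subseteq> carrier R" "\<zero> \<in> V" "\<And>v w. v \<in> V \<Longrightarrow> w \<in> V \<Longrightarrow> v \<oplus> w \<in> V"
    and "\<And>k v. k \<in> K \<Longrightarrow> v \<in> V \<Longrightarrow> k \<otimes> v \<in> V" and "subfield K R"
  shows "subalgebra K V R"
proof -
  have "\<ominus> v \<in> V" if "v \<in> V" for v
  proof -
    have "\<ominus> \<one> \<in> K" using subringE(3,5)[OF subfieldE(1)[OF assms(5)]] by auto
    hence "\<ominus> \<one> \<otimes> v \<in> V" using assms(4) that by blast
    thus ?thesis using that assms(1) l_minus[of \<one> v] by auto
  qed
  hence "subgroup V (add_monoid R)"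
    using assms(1,2,3) by (intro add.subgroupI) (auto simp: a_inv_def)
  thus ?thesis using assms(4) by (auto simp: subalgebra_def subalgebra_axioms_def)
qed

lemma subalgebraE:
  assumes "subalgebra K V R"
  shows "V \<subseteq> carrier R" "\<zero> \<in> V" "\<And>v w. v \<in> V \<Longrightarrow> w \<in> V \<Longrightarrow> v \<oplus> w \<in> V"
    and "\<And>k v. k \<in> K \<Longrightarrow> v \<in> V \<Longrightarrow> k \<otimes> v \<in> V" and "\<And>v. v \<in> V \<Longrightarrow> \<ominus> v \<in> V"
    and "\<And>v w. v \<in> V \<Longrightarrow> w \<in> V \<Longrightarrow> v \<ominus> w \<in> V"
proof -
  interpret V: subalgebra K V R by fact
  show "V \<subseteq> carrier R" "\<zero> \<in> V" "\<And>v w. v \<in> V \<Longrightarrow> w \<in> V \<Longrightarrow> v \<oplus> w \<in> V"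
    and "\<And>k v. k \<in> K \<Longrightarrow> v \<in> V \<Longrightarrow> k \<otimes> v \<in> V" and m: "\<And>v. v \<in> V \<Longrightarrow> \<ominus> v \<in> V"
    using V.subset V.one_closed V.m_closed V.smult_closed V.m_inv_closed by (auto simp: a_inv_def)
  thus "\<And>v w. v \<in> V \<Longrightarrow> w \<in> V \<Longrightarrow> v \<ominus> w \<in> V" by (auto simp: a_minus_def)
qed

text \<open>This is the dimension formula for sums, written multiplicatively so that no exponents
  are subtracted.\<close>

lemma
  assumes "finite (carrier R)" "subfield K R" "subalgebra K V R" "subalgebra K W R"
  shows subalgebra_set_add: "subalgebra K (V <+>\<^bsub>R\<^esub> W) R"
    and card_set_add: "card (V <+>\<^bsub>R\<^esub> W) * card (V \<inter> W) = card V * card W"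
proof -
  note dim = dimension_iff_card[OF assms(1,2)]
  obtain i j k where d: "dimension i K V" "dimension j K W" "dimension k K (V \<inter> W)"
    using subalgebra_imp_dimension[OF assms(1,2)] assms(3,4) subalgebra_inter[OF assms(3,4)] by metis
  have s: "dimension (i + j - k) K (V <+>\<^bsub>R\<^esub> W)"
    using dimension_sum_space[OF assms(2) d] .
  show "subalgebra K (V <+>\<^bsub>R\<^esub> W) R" using s dim by blast
  have "finite V" using subalgebraE(1)[OF assms(3)] assms(1) finite_subset by blast
  hence "card (V \<inter> W) \<le> card V" by (simp add: card_mono)
  moreover have "1 < card K"
    using subfield_card_ge_2[OF assms(2)] finite_subset[OF subfieldE(3)[OF assms(2)] assms(1)] by simp
  \<comment> \<open>The exponent \<open>i + j - k\<close> is a truncated difference of naturals;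
    this bound makes it a true one.\<close>
  ultimately have "k \<le> i" using d dim by (metis power_le_imp_le_exp)
  thus "card (V <+>\<^bsub>R\<^esub> W) * card (V \<inter> W) = card V * card W"
    using d s dim by (simp flip: power_add)
qed

end

section \<open>Subspaces that multiplication by an element almost preserves\<close>

text \<open>The base field is a parameter of its own so that the theory can be instantiated a second
  time with \<open>K(b)\<close> in place of \<open>K\<close>.\<close>

locale finite_extension = field R for R (structure) +
  fixes K
  assumes fin: "finite (carrier R)" and K: "subfield K R"
begin

section \<open>Sizes and multiplicative translates of subspaces\<close>

lemma K_carrier: "K \<subseteq> carrier R"
  using subfieldE(3)[OF K] .

lemma finite_K: "finite K"
  using finite_subset[OF K_carrier fin] .

lemma card_K: "card K \<ge> 2"
  using subfield_card_ge_2[OF K finite_K] .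

lemma finite_subspace: "subalgebra K V R \<Longrightarrow> finite V"
  using finite_subset[OF subalgebra_in_carrier fin] .

lemma card_subspace_pos: "subalgebra K V R \<Longrightarrow> card V > 0"
  using finite_subspace subalgebraE(2) by (metis card_gt_0_iff empty_iff)

lemma card_subspace: "subalgebra K V R \<Longrightarrow> \<exists>k. card V = card K ^ k"
  using subalgebra_imp_dimension[OF fin K] dimension_iff_card[OF fin K] by blast

lemma inj_on_mult: "c \<in> carrier R \<Longrightarrow> c \<noteq> \<zero> \<Longrightarrow> V \<subseteq> carrier R \<Longrightarrow> inj_on ((\<otimes>) c) V"
  by (auto intro!: inj_onI simp: m_lcancel subset_iff)

lemma l_coset_eq_image: "c <#\<^bsub>R\<^esub> V = (\<otimes>) c ` V"
  by (auto simp: l_coset_def)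

lemma card_l_coset: "c \<in> carrier R \<Longrightarrow> c \<noteq> \<zero> \<Longrightarrow> V \<subseteq> carrier R \<Longrightarrow> card (c <#\<^bsub>R\<^esub> V) = card V"
  unfolding l_coset_eq_image using card_image inj_on_mult by blast

lemma subalgebra_l_coset:
  assumes "c \<in> carrier R" "subalgebra K V R"
  shows "subalgebra K (c <#\<^bsub>R\<^esub> V) R"
proof (rule subalgebraI[OF _ _ _ _ K])
  note V = subalgebraE[OF assms(2)]
  show "c <#\<^bsub>R\<^esub> V \<subseteq> carrier R" using V(1) assms(1) by (auto simp: l_coset_eq_image)
  show "\<zero> \<in> c <#\<^bsub>R\<^esub> V" using V(2) assms(1) by (force simp: l_coset_eq_image)
  show "v \<oplus> w \<in> c <#\<^bsub>R\<^esub> V" if "v \<in> c <#\<^bsub>R\<^esub> V" "w \<in> c <#\<^bsub>R\<^esub> V" for v w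
  proof -
    from that obtain v' w' where "v' \<in> V" "w' \<in> V" "v = c \<otimes> v'" "w = c \<otimes> w'"
      by (auto simp: l_coset_eq_image)
    moreover from this have "v \<oplus> w = c \<otimes> (v' \<oplus> w')" using V(1) assms(1) by (simp add: r_distr subset_iff)
    ultimately show ?thesis using V(3) by (auto simp: l_coset_eq_image)
  qed
  show "k \<otimes> v \<in> c <#\<^bsub>R\<^esub> V" if "k \<in> K" "v \<in> c <#\<^bsub>R\<^esub> V" for k v
  proof -
    from that obtain v' where "v' \<in> V" "v = c \<otimes> v'"
      by (auto simp: l_coset_eq_image)
    moreover from this have "k \<otimes> v = c \<otimes> (k \<otimes> v')"
      using V(1) assms(1) K_carrier that by (simp add: m_lcomm subset_iff)
    ultimately show ?thesis using V(4) that by (auto simp: l_coset_eq_image)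
  qed
qed

text \<open>A subspace stable under \<open>b\<close> is a module over \<open>K(b)\<close>, because the multipliers of a finite set
  form a subfield.\<close>

lemma subalgebra_generate_field:
  assumes b: "b \<in> carrier R" and V: "subalgebra K V R" and stable: "\<And>x. x \<in> V \<Longrightarrow> b \<otimes> x \<in> V"
  shows "subalgebra (generate_field R (insert b K)) V R"
proof -
  note V' = subalgebraE[OF V]
  define M where "M = {x \<in> carrier R. \<forall>v \<in> V. x \<otimes> v \<in> V}"
  have Vc: "v \<in> carrier R" if "v \<in> V" for v using V'(1) that by auto
  have "subring M R"
    by (rule subringI) (auto simp: M_def Vc l_minus m_assoc l_distr V'(3,5))
  moreover have "inv x \<in> M" if x: "x \<in> M - {\<zero>}" for x
  proof -
    have xc: "x \<in> carrier R" "x \<noteq> \<zero>" "x \<in> Units R" using x field_Units by (auto simp: M_def)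
    \<comment> \<open>Multiplication by a nonzero \<open>x\<close> is injective on the finite set
      \<open>V\<close>, hence onto. This is what closes the multipliers under inverses.\<close>
    have "(\<otimes>) x ` V = V"
      using x V'(1) inj_on_mult[OF xc(1,2) V'(1)] finite_subspace[OF V]
      by (intro endo_inj_surj) (auto simp: M_def)
    hence "inv x \<otimes> v \<in> V" if "v \<in> V" for v
    proof -
      obtain w where w: "w \<in> V" "v = x \<otimes> w" using \<open>(\<otimes>) x ` V = V\<close> \<open>v \<in> V\<close> by blast
      hence "inv x \<otimes> v = w"
        using xc Vc by (simp flip: m_assoc)
      thus ?thesis using w by simp
    qed
    thus ?thesis using xc by (auto simp: M_def)
  qed
  ultimately have M: "subfield M R" by (intro subfieldI') auto
  have "insert b K \<subseteq> M"
    using b stable K_carrier V'(4) by (auto simp: M_def)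
  hence "generate_field R (insert b K) \<subseteq> M"
    using generate_field_min_subfield1[OF _ M] b K_carrier by auto
  thus ?thesis
    using subalgebraI[OF V'(1,2,3) _ generate_field_is_subfield[of "insert b K"]] b K_carrier
    by (auto simp: M_def)
qed

section \<open>Passing between the base fields \<open>K\<close> and \<open>K(b)\<close>\<close>

lemma K_subset_generate_field: "K \<subseteq> generate_field R (insert b K)"
  by (auto intro: generate_field.incl)

lemma subalgebra_restrict:
  "subalgebra (generate_field R (insert b K)) V R \<Longrightarrow> subalgebra K V R"
  using K_subset_generate_field[of b] unfolding subalgebra_def subalgebra_axioms_def by blast

lemma generate_field_subalgebra:
  assumes "b \<in> carrier R"
  shows "subalgebra K (generate_field R (insert b K)) R"
proof -
  have "subfield (generate_field R (insert b K)) R"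
    using assms K_carrier by (intro generate_field_is_subfield) simp
  note E = subfieldE(1,3)[OF this]
  show ?thesis
    using K_subset_generate_field
    by (intro subalgebraI[OF E(2) subringE(2)[OF E(1)] _ _ K])
      (auto intro: subringE(6,7)[OF E(1)])
qed

text \<open>For invertible \<open>b\<close> this is the intersection of \<open>V\<close> with its
  translate by \<open>inv b\<close>. Iterating the operator descends to the largest part of
  \<open>V\<close> that is stable under \<open>b\<close>.\<close>

definition stable_part :: "'a \<Rightarrow> 'a set \<Rightarrow> 'a set"
  where "stable_part b V = {x \<in> V. b \<otimes> x \<in> V}"

lemma stable_part_subset: "stable_part b V \<subseteq> V"
  by (auto simp: stable_part_def)

lemma subalgebra_stable_part:
  assumes "b \<in> carrier R" "subalgebra K V R"
  shows "subalgebra K (stable_part b V) R"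
proof -
  note V = subalgebraE[OF assms(2)]
  have c: "v \<in> carrier R" if "v \<in> V" for v using V(1) that by auto
  have Kc: "k \<in> carrier R" if "k \<in> K" for k using K_carrier that by auto
  show ?thesis
    by (rule subalgebraI[OF _ _ _ _ K])
      (auto simp: stable_part_def r_distr m_lcomm[of b] assms(1) c Kc V(2,3,4))
qed

text \<open>Multiplication by \<open>b\<close> carries \<open>stable_part b V\<close> bijectively
  onto the intersection of \<open>V\<close> and \<open>b V\<close>, so the dimension formula for
  \<open>V + b V\<close> gives the claim.\<close>

lemma card_sum_stable_part:
  assumes "b \<in> carrier R" "b \<noteq> \<zero>" "subalgebra K V R"
  shows "card (V <+>\<^bsub>R\<^esub> (b <#\<^bsub>R\<^esub> V)) * card (stable_part b V) = card V * card V"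
proof -
  note V = subalgebraE[OF assms(3)]
  have "V \<inter> (b <#\<^bsub>R\<^esub> V) = b <#\<^bsub>R\<^esub> stable_part b V"
    by (auto simp: l_coset_eq_image stable_part_def)
  hence "card (V \<inter> (b <#\<^bsub>R\<^esub> V)) = card (stable_part b V)"
    using card_l_coset[OF assms(1,2)] stable_part_subset V(1) by (metis subset_trans)
  thus ?thesis
    using card_set_add[OF fin K assms(3) subalgebra_l_coset[OF assms(1,3)]]
      card_l_coset[OF assms(1,2) V(1)] by simp
qed

text \<open>Both \<open>D\<close> and \<open>b D\<close> lie in \<open>V\<close>, so
  \<open>D + b D\<close> is at most \<open>card K\<close> times larger than \<open>D\<close>. By the
  product formula the next step then has codimension at most 1 as well.\<close>

lemma card_stable_part_stable_part:
  assumes "b \<in> carrier R" "b \<noteq> \<zero>" "subalgebra K V R" "card V = card K * card (stable_part b V)"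
  defines "D \<equiv> stable_part b V"
  shows "stable_part b D = D \<or> card D = card K * card (stable_part b D)"
proof -
  have D: "subalgebra K D R" "subalgebra K (stable_part b D) R"
    unfolding D_def using assms subalgebra_stable_part by auto
  have sub: "D <+>\<^bsub>R\<^esub> (b <#\<^bsub>R\<^esub> D) \<subseteq> V"
    using subalgebraE(3)[OF assms(3)]
    by (auto simp: set_add_mem_iff l_coset_eq_image D_def stable_part_def)
  have "card D * card D = card (D <+>\<^bsub>R\<^esub> (b <#\<^bsub>R\<^esub> D)) * card (stable_part b D)"
    using card_sum_stable_part[OF assms(1,2) D(1)] by simp
  also have "\<dots> \<le> card V * card (stable_part b D)"
    using card_mono[OF finite_subspace[OF assms(3)] sub] by simp
  also have "\<dots> = card D * (card K * card (stable_part b D))"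
    using assms(4) by (simp add: D_def)
  finally have le: "card D \<le> card K * card (stable_part b D)"
    using card_subspace_pos[OF D(1)] by simp
  obtain i j where ij: "card D = card K ^ i" "card (stable_part b D) = card K ^ j"
    using card_subspace D by metis
  have "card (stable_part b D) \<le> card D"
    using card_mono[OF finite_subspace[OF D(1)] stable_part_subset] .
  moreover have "1 < card K" using card_K by simp
  \<comment> \<open>Both sizes are powers of \<open>card K\<close>, so the two inequalities leave
    only two possible exponents.\<close>
  ultimately have "j \<le> i" "i \<le> Suc j"
    using le power_le_imp_le_exp[of "card K" j i] power_le_imp_le_exp[of "card K" i "Suc j"]
    unfolding ij power_Suc by blast+
  then consider "i = j" | "i = Suc j" by linarith
  thus ?thesis
  proof cases
    case 1
    thus ?thesis using ij card_subset_eq[OF finite_subspace[OF D(1)] stable_part_subset] by metis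
  next
    case 2
    thus ?thesis using ij by simp
  qed
qed

text \<open>Data read off at the end of the descending chain: \<open>S'\<close> is its last term,
  \<open>m\<close> the number of strict steps, and \<open>c\<close> a vector with \<open>m\<close>
  consecutive multiples by powers of \<open>b\<close> inside \<open>V\<close>. Maximality of
  \<open>S'\<close> is stated for arbitrary stable subsets, so that it applies to a set such as
  \<open>c K(b)\<close> directly.\<close>

definition chain_generator :: "'a \<Rightarrow> 'a set \<Rightarrow> 'a set \<Rightarrow> 'a \<Rightarrow> nat \<Rightarrow> bool"
  where "chain_generator b V S' c m \<longleftrightarrow>
    subalgebra K S' R \<and> S' \<subseteq> V \<and> (\<forall>x \<in> S'. b \<otimes> x \<in> S')
    \<and> (\<forall>W. W \<subseteq> V \<longrightarrow> (\<forall>x \<in> W. b \<otimes> x \<in> W) \<longrightarrow> W \<subseteq> S')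
    \<and> c \<in> V - S' \<and> m \<ge> 1 \<and> (\<forall>i < m. c \<otimes> b [^] i \<in> V) \<and> card V = card S' * card K ^ m"

text \<open>Induction on the size of \<open>V\<close>, passing to
  \<open>D = stable_part b V\<close>. The same \<open>S'\<close> and \<open>c\<close> serve for
  \<open>D\<close> and for \<open>V\<close>; going back up to \<open>V\<close> gains one more power
  of \<open>b\<close>.\<close>

lemma exists_chain_generator:
  assumes "b \<in> carrier R" "b \<noteq> \<zero>" "subalgebra K V R" "card V = card K * card (stable_part b V)"
  shows "\<exists>S' c m. chain_generator b V S' c m"
  using assms(3,4)
proof (induction "card V" arbitrary: V rule: less_induct)
  case less
  define D where "D = stable_part b V"
  have D: "subalgebra K D R" using less.prems assms(1) subalgebra_stable_part D_def by auto
  have DV: "D \<subseteq> V" unfolding D_def by (rule stable_part_subset)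
  have lt: "card D < card V"
    using less.prems(2) card_K card_subspace_pos[OF D] by (simp add: D_def)
  \<comment> \<open>A stable subset of \<open>V\<close> already lies in \<open>D\<close>, so
    maximality inside \<open>D\<close> gives maximality inside \<open>V\<close>.\<close>
  have inD: "W \<subseteq> D" if "W \<subseteq> V" "\<forall>x \<in> W. b \<otimes> x \<in> W" for W
    using that by (auto simp: D_def stable_part_def)
  consider "stable_part b D = D" | "card D = card K * card (stable_part b D)"
    using card_stable_part_stable_part[OF assms(1,2) less.prems] D_def by auto
  thus ?case
  proof cases
    case 1
    \<comment> \<open>The chain stops at \<open>D\<close>: here \<open>S' = D\<close> and
      \<open>m = 1\<close>, and any vector of \<open>V\<close> outside \<open>D\<close> serves as
      \<open>c\<close>.\<close>
    obtain c where c: "c \<in> V - D" using lt DV by (metis DiffI less_irrefl subsetI subset_antisym)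
    have cc: "c \<in> carrier R" using c subalgebraE(1)[OF less.prems(1)] by auto
    have "\<forall>x \<in> D. b \<otimes> x \<in> D" using 1 by (auto simp: stable_part_def)
    moreover have "\<forall>i < 1. c \<otimes> b [^] (i::nat) \<in> V" using c cc by auto
    moreover have "card V = card D * card K ^ 1" using less.prems(2) by (simp add: D_def)
    moreover have "\<forall>W. W \<subseteq> V \<longrightarrow> (\<forall>x \<in> W. b \<otimes> x \<in> W) \<longrightarrow> W \<subseteq> D" using inD by simp
    ultimately show ?thesis
      using D DV c unfolding chain_generator_def
      by (intro exI[of _ D] exI[of _ c] exI[of _ 1] conjI) simp_all
  next
    case 2
    obtain S' c m where "chain_generator b D S' c m"
      using less.hyps[OF lt D 2] by blast
    hence IH: "subalgebra K S' R" "S' \<subseteq> D" "\<forall>x \<in> S'. b \<otimes> x \<in> S'"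
        "\<forall>W. W \<subseteq> D \<longrightarrow> (\<forall>x \<in> W. b \<otimes> x \<in> W) \<longrightarrow> W \<subseteq> S'"
        "c \<in> D - S'" "m \<ge> 1" "\<forall>i < m. c \<otimes> b [^] i \<in> D" "card D = card S' * card K ^ m"
      by (auto simp: chain_generator_def)
    have cc: "c \<in> carrier R" using IH(5) subalgebraE(1)[OF D] by auto
    have "c \<otimes> b [^] i \<in> V" if i: "i < Suc m" for i
    proof (cases i)
      case 0
      thus ?thesis using IH(5) DV cc by auto
    next
      case (Suc j)
      \<comment> \<open>The multiple for \<open>j\<close> lies in \<open>D\<close>, and elements of
        \<open>D\<close> stay in \<open>V\<close> after one multiplication by
        \<open>b\<close>.\<close>
      hence "b \<otimes> (c \<otimes> b [^] j) \<in> V" using IH(7) i by (auto simp: D_def stable_part_def)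
      moreover have "c \<otimes> b [^] i = b \<otimes> (c \<otimes> b [^] j)"
        using cc assms(1) Suc by (simp add: m_ac)
      ultimately show ?thesis by simp
    qed
    moreover have "card V = card S' * card K ^ Suc m"
      using less.prems(2) IH(8) by (simp add: D_def)
    moreover have "\<forall>W. W \<subseteq> V \<longrightarrow> (\<forall>x \<in> W. b \<otimes> x \<in> W) \<longrightarrow> W \<subseteq> S'" using inD IH(4) by simp
    ultimately show ?thesis
      using IH(1,2,3,5) DV unfolding chain_generator_def
      by (intro exI[of _ S'] exI[of _ c] exI[of _ "Suc m"] conjI) auto
  qed
qed

end

section \<open>Powers of a generator\<close>

context ring
begin

text \<open>A size bound that does not presuppose independence; it is used below to prove the
  independence of powers.\<close>

lemma card_Span_le:
  assumes "subfield K R" "finite K" "set Us \<subseteq> carrier R"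
  shows "finite (Span K Us) \<and> card (Span K Us) \<le> card K ^ length Us"
  using assms(3)
proof (induction Us)
  case Nil
  thus ?case by simp
next
  case (Cons u Us)
  hence IH: "finite (Span K Us)" "card (Span K Us) \<le> card K ^ length Us" by auto
  have img: "Span K (u # Us) = (\<lambda>(k, e). k \<otimes> u \<oplus> e) ` (K \<times> Span K Us)"
    unfolding set_eq_iff image_iff by (simp add: Bex_def line_extension_mem_iff)
  have "card (Span K (u # Us)) \<le> card (K \<times> Span K Us)"
    unfolding img using IH(1) assms(2) by (intro card_image_le) simp
  also have "\<dots> \<le> card K ^ length (u # Us)"
    using IH(2) by (simp add: card_cartesian_product)
  finally show ?case using img IH(1) assms(2) by (metis finite_SigmaI finite_imageI)
qed

text \<open>Connects the list combinations behind \<open>Span\<close> with the indexed sums used to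
  describe the points.\<close>

lemma combine_map_upt:
  assumes "\<And>i. i < m \<Longrightarrow> x i \<in> carrier R" "\<And>i. i < m \<Longrightarrow> f i \<in> carrier R"
  shows "combine (map x [0..<m]) (map f [0..<m]) = (\<Oplus>i \<in> {..<m}. x i \<otimes> f i)"
  using assms
proof (induction m)
  case 0
  thus ?case by simp
next
  case (Suc m)
  have "combine (map x [0..<Suc m]) (map f [0..<Suc m])
      = combine (map x [0..<m]) (map f [0..<m]) \<oplus> combine [x m] [f m]"
    using Suc.prems combine_append[of "map x [0..<m]" "map f [0..<m]" "[x m]" "[f m]"]
    by (simp add: image_subset_iff)
  also have "\<dots> = (\<Oplus>i \<in> {..<m}. x i \<otimes> f i) \<oplus> x m \<otimes> f m"
    using Suc by simp
  also have "\<dots> = (\<Oplus>i \<in> {..<Suc m}. x i \<otimes> f i)"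
    using Suc.prems by (simp add: lessThan_Suc Pi_iff a_comm)
  finally show ?case .
qed

end

context finite_extension
begin

lemma powers_carrier: "b \<in> carrier R \<Longrightarrow> set (map (\<lambda>i. b [^] i) [0..<m]) \<subseteq> carrier R" for m :: nat
  by auto

text \<open>If \<open>b [^] m\<close> were in the span of the lower powers, that span would be
  stable under \<open>b\<close> and contain \<open>\<one>\<close>. It would then contain
  \<open>K(b)\<close>, whose size \<open>card K ^ t\<close> is too large for \<open>m < t\<close>
  generators.\<close>

lemma independent_powers:
  fixes m t :: nat
  assumes b: "b \<in> carrier R" and t: "card (generate_field R (insert b K)) = card K ^ t"
    and "m \<le> t"
  shows "independent K (map (\<lambda>i. b [^] i) [0..<m])"
proof -
  \<comment> \<open>The list is reversed because independence is extended at the head, so the newest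
    power has to come first.\<close>
  have "independent K (map (\<lambda>i. b [^] i) (rev [0..<m]))"
    using \<open>m \<le> t\<close>
  proof (induction m)
    case 0
    thus ?case by simp
  next
    case (Suc m)
    let ?W = "Span K (map (\<lambda>i. b [^] i) (rev [0..<m]))"
    have car: "set (map (\<lambda>i. b [^] i) (rev [0..<m])) \<subseteq> carrier R" using b by auto
    have W: "subalgebra K ?W R" using Span_is_subalgebra[OF K car] .
    have "b [^] m \<notin> ?W"
    proof
      assume in_W: "b [^] m \<in> ?W"
      \<comment> \<open>The assumption supplies the top power \<open>i = m\<close>, which is what
        closes \<open>?W\<close> under multiplication by \<open>b\<close>.\<close>
      have pow: "b [^] i \<in> ?W" if "i \<le> m" for i
        using that in_W Span_base_incl[OF K car] by (cases "i = m") (auto simp: image_subset_iff)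
      let ?V = "stable_part b ?W"
      have "b [^] i \<in> ?V" if "i < m" for i
        using that pow[of i] pow[of "Suc i"] b by (simp add: stable_part_def m_comm del: Span.simps)
      hence "?W \<subseteq> ?V"
        by (intro subalgebra_Span_incl[OF K subalgebra_stable_part[OF b W]]) auto
      hence "subalgebra (generate_field R (insert b K)) ?W R"
        by (intro subalgebra_generate_field[OF b W]) (auto simp: stable_part_def)
      moreover have "\<one> \<in> ?W" using pow[of 0] by simp
      ultimately have "e \<in> ?W" if "e \<in> generate_field R (insert b K)" for e
        using subalgebraE(4) that generate_field_in_carrier[of "insert b K" e] b K_carrier
        by (metis insert_subset r_one)
      hence "card (generate_field R (insert b K)) \<le> card ?W"
        using card_Span_le[OF K finite_K car] by (intro card_mono) auto
      hence "card K ^ t \<le> card K ^ m"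
        using card_Span_le[OF K finite_K car] t by simp
      moreover have "1 < card K" using card_K by simp
      ultimately show False using \<open>Suc m \<le> t\<close> power_le_imp_le_exp by fastforce
    qed
    thus ?case using Suc b by (auto intro!: li_Cons simp del: Span.simps)
  qed
  thus ?thesis by (rule independent_same_set[OF K, rotated -1]) auto
qed

text \<open>The \<open>t\<close> independent powers span a subset of \<open>K(b)\<close> that has
  the full size \<open>card K ^ t\<close>.\<close>

lemma Span_powers:
  fixes t :: nat
  assumes b: "b \<in> carrier R" and t: "card (generate_field R (insert b K)) = card K ^ t"
  shows "Span K (map (\<lambda>i. b [^] i) [0..<t]) = generate_field R (insert b K)"
proof -
  let ?E = "generate_field R (insert b K)"
  have E: "subfield ?E R" using b K_carrier by (intro generate_field_is_subfield) auto
  have bE: "b [^] i \<in> ?E" for i :: nat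
    by (induction i) (auto intro: generate_field.intros)
  have "Span K (map (\<lambda>i. b [^] i) [0..<t]) \<subseteq> ?E"
    using bE by (intro subalgebra_Span_incl[OF K generate_field_subalgebra[OF b]]) auto
  moreover have "card (Span K (map (\<lambda>i. b [^] i) [0..<t])) = card ?E"
    using card_dimension[OF K finite_K dimension_independent[OF independent_powers[OF b t order_refl]]] t
    by simp
  ultimately show ?thesis
    using finite_subset[OF subfieldE(3)[OF E] fin] card_subset_eq by blast
qed

text \<open>The first part supplies coordinates on
  \<open>c \<langle>1, ..., b^(m-1)\<rangle>\<close>, the second turns "nonzero vector" into
  "coordinates not all zero". The sums run over \<open>{..m - 1}\<close>, which agrees with
  \<open>{..<m}\<close> because \<open>m \<ge> 1\<close>.\<close>

lemma coset_Span_powers: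
  fixes m :: nat
  assumes "b \<in> carrier R" "c \<in> carrier R" "m \<ge> 1"
  shows "c <#\<^bsub>R\<^esub> Span K (map (\<lambda>i. b [^] i) [0..<m])
    = {(\<Oplus>i \<in> {..m - 1}. c \<otimes> x i \<otimes> b [^] i) | x. x \<in> {..m - 1} \<rightarrow> K}"
    and "c \<noteq> \<zero> \<Longrightarrow> independent K (map (\<lambda>i. b [^] i) [0..<m]) \<Longrightarrow> x \<in> {..m - 1} \<rightarrow> K \<Longrightarrow>
      (\<Oplus>i \<in> {..m - 1}. c \<otimes> x i \<otimes> b [^] i) = \<zero> \<longleftrightarrow> (\<forall>i \<in> {..m - 1}. x i = \<zero>)"
proof -
  let ?Bs = "map (\<lambda>i. b [^] i) [0..<m]"
  have set: "{..m - 1} = {..<m}" using assms(3) by auto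
  have sum: "(\<Oplus>i \<in> {..m - 1}. c \<otimes> x i \<otimes> b [^] i) = c \<otimes> combine (map x [0..<m]) ?Bs"
    if x: "x \<in> {..m - 1} \<rightarrow> K" for x
  proof -
    have xc: "x i \<in> carrier R" if "i < m" for i using x K_carrier that by (auto simp: set)
    have "(\<Oplus>i \<in> {..<m}. c \<otimes> x i \<otimes> b [^] i) = (\<Oplus>i \<in> {..<m}. c \<otimes> (x i \<otimes> b [^] i))"
      using xc assms by (intro finsum_cong') (auto simp: m_assoc)
    also have "\<dots> = c \<otimes> (\<Oplus>i \<in> {..<m}. x i \<otimes> b [^] i)"
      using xc assms by (subst finsum_rdistr) auto
    also have "(\<Oplus>i \<in> {..<m}. x i \<otimes> b [^] i) = combine (map x [0..<m]) ?Bs"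
      using xc assms by (subst combine_map_upt) auto
    finally show ?thesis unfolding set .
  qed
  have span: "Span K ?Bs = {combine (map x [0..<m]) ?Bs | x. x \<in> {..m - 1} \<rightarrow> K}"
  proof -
    have "\<exists>x. x \<in> {..m - 1} \<rightarrow> K \<and> Ks = map x [0..<m]" if "set Ks \<subseteq> K" "length Ks = m" for Ks
    proof (intro exI conjI)
      show "(!) Ks \<in> {..m - 1} \<rightarrow> K" unfolding set using that nth_mem by blast
      show "Ks = map ((!) Ks) [0..<m]" using that map_nth[of Ks] by simp
    qed
    moreover have "set (map x [0..<m]) \<subseteq> K" if "x \<in> {..m - 1} \<rightarrow> K" for x
      using that by (auto simp: set)
    ultimately show ?thesis
      unfolding set_eq_iff Span_mem_iff_length_version[OF K powers_carrier[OF assms(1)]] mem_Collect_eq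
      by (metis length_map length_upt diff_zero)
  qed
  show "c <#\<^bsub>R\<^esub> Span K ?Bs = {(\<Oplus>i \<in> {..m - 1}. c \<otimes> x i \<otimes> b [^] i) | x. x \<in> {..m - 1} \<rightarrow> K}"
    unfolding span l_coset_eq_image using sum by force
  assume c: "c \<noteq> \<zero>" and ind: "independent K ?Bs" and x: "x \<in> {..m - 1} \<rightarrow> K"
  have xK: "set (map x [0..<m]) \<subseteq> K" using x by (auto simp: set)
  have "combine (map x [0..<m]) ?Bs \<in> carrier R"
    using xK K_carrier powers_carrier[OF assms(1)] by (intro combine_in_carrier) auto
  hence "(\<Oplus>i \<in> {..m - 1}. c \<otimes> x i \<otimes> b [^] i) = \<zero> \<longleftrightarrow> combine (map x [0..<m]) ?Bs = \<zero>"
    unfolding sum[OF x] using c assms(2) by (auto simp: integral_iff)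
  also have "\<dots> \<longleftrightarrow> (\<forall>i \<in> {..m - 1}. x i = \<zero>)"
  proof
    assume "combine (map x [0..<m]) ?Bs = \<zero>"
    from independent_imp_trivial_combine[OF K ind xK this]
    show "\<forall>i \<in> {..m - 1}. x i = \<zero>" unfolding set by (auto simp: image_subset_iff)
  next
    assume "\<forall>i \<in> {..m - 1}. x i = \<zero>"
    hence "map x [0..<m] = replicate (length ?Bs) \<zero>"
      unfolding set by (intro nth_equalityI) auto
    thus "combine (map x [0..<m]) ?Bs = \<zero>"
      using combine_replicate[OF powers_carrier[OF assms(1)]] by simp
  qed
  finally show "(\<Oplus>i \<in> {..m - 1}. c \<otimes> x i \<otimes> b [^] i) = \<zero> \<longleftrightarrow> (\<forall>i \<in> {..m - 1}. x i = \<zero>)" .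
qed

text \<open>Take the chain generator \<open>c\<close> and the largest stable part \<open>S'\<close>.
  The translate of the power span by \<open>c\<close> lies in \<open>V\<close> and meets
  \<open>S'\<close> trivially, because \<open>S'\<close> is a \<open>K(b)\<close>-space without
  \<open>c\<close>. Comparing sizes shows that the two parts fill \<open>V\<close>.\<close>

lemma almost_stable_decomposition:
  assumes b: "b \<in> carrier R" "b \<noteq> \<zero>" and V: "subalgebra K V R"
    and cV: "card V = card K * card (stable_part b V)"
    and t: "card (generate_field R (insert b K)) = card K ^ t"
  defines "E \<equiv> generate_field R (insert b K)"
  obtains S' c m where "subalgebra E S' R" "c \<in> carrier R - {\<zero>}" "1 \<le> m" "m < t"
    "card V = card S' * card K ^ m" "(c <#\<^bsub>R\<^esub> E) \<inter> S' = {\<zero>}"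
    "V = S' <+>\<^bsub>R\<^esub> (c <#\<^bsub>R\<^esub> Span K (map (\<lambda>i. b [^] i) [0..<m]))"
    "S' \<inter> (c <#\<^bsub>R\<^esub> Span K (map (\<lambda>i. b [^] i) [0..<m])) = {\<zero>}"
proof -
  obtain S' c m where "chain_generator b V S' c m"
    using exists_chain_generator[OF b V cV] by blast
  hence S': "subalgebra K S' R" "S' \<subseteq> V" "\<forall>x \<in> S'. b \<otimes> x \<in> S'"
      "\<forall>W. W \<subseteq> V \<longrightarrow> (\<forall>x \<in> W. b \<otimes> x \<in> W) \<longrightarrow> W \<subseteq> S'"
      "c \<in> V" "c \<notin> S'" "m \<ge> 1" "\<forall>i < m. c \<otimes> b [^] i \<in> V" "card V = card S' * card K ^ m"
    by (auto simp: chain_generator_def)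
  have E: "subfield E R" unfolding E_def using b K_carrier by (intro generate_field_is_subfield) auto
  note E' = subringE[OF subfieldE(1)[OF E]]
  have bE: "b \<in> E" unfolding E_def by (auto intro: generate_field.incl)
  have S'E: "subalgebra E S' R" unfolding E_def
    using subalgebra_generate_field[OF b(1) S'(1)] S'(3) by blast
  have c: "c \<in> carrier R" "c \<noteq> \<zero>"
    using S'(5,6) subalgebraE(1)[OF V] subalgebraE(2)[OF S'(1)] by auto
  let ?P = "\<lambda>m. Span K (map (\<lambda>i. b [^] i) [0..<m])"
  have P: "subalgebra K (?P k) R" for k :: nat
    using Span_is_subalgebra[OF K powers_carrier[OF b(1)]] .
  have cP_V: "c <#\<^bsub>R\<^esub> ?P k \<subseteq> V" if "k \<le> m" for k
  proof -
    \<comment> \<open>The preimage of \<open>V\<close> under multiplication by \<open>c\<close> is a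
      subspace, so it suffices that it contains the powers themselves.\<close>
    define W where "W = {x \<in> carrier R. c \<otimes> x \<in> V}"
    have Kc: "k \<in> carrier R" if "k \<in> K" for k using K_carrier that by auto
    have "subalgebra K W R"
      by (rule subalgebraI[OF _ _ _ _ K])
        (auto simp: W_def c subalgebraE(2,3,4)[OF V] r_distr Kc m_lcomm[of c])
    moreover have "set (map (\<lambda>i. b [^] i) [0..<k]) \<subseteq> W"
      using that S'(8) b by (auto simp: W_def)
    ultimately have "?P k \<subseteq> W" using subalgebra_Span_incl[OF K] by blast
    thus ?thesis by (auto simp: W_def l_coset_eq_image)
  qed
  \<comment> \<open>With \<open>t\<close> or more powers available, all of \<open>c K(b)\<close>
    would be a stable subset of \<open>V\<close> and hence lie in \<open>S'\<close>, although it
    contains \<open>c\<close>.\<close>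
  have m_t: "m < t"
  proof (rule ccontr)
    assume "\<not> m < t"
    hence "c <#\<^bsub>R\<^esub> E \<subseteq> V" using cP_V[of t] Span_powers[OF b(1) t] E_def by simp
    moreover have "b \<otimes> x \<in> c <#\<^bsub>R\<^esub> E" if "x \<in> c <#\<^bsub>R\<^esub> E" for x
    proof -
      from that obtain e where e: "e \<in> E" "x = c \<otimes> e" by (auto simp: l_coset_eq_image)
      hence "b \<otimes> x = c \<otimes> (b \<otimes> e)" using c b E'(1) by (auto intro: m_lcomm)
      thus ?thesis using E'(6)[OF bE e(1)] by (auto simp: l_coset_eq_image)
    qed
    ultimately have "c <#\<^bsub>R\<^esub> E \<subseteq> S'" using S'(4) by blast
    moreover have "c \<in> c <#\<^bsub>R\<^esub> E" using E'(3) c by (force simp: l_coset_eq_image)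
    ultimately show False using S'(6) by blast
  qed
  have cE: "(c <#\<^bsub>R\<^esub> E) \<inter> S' = {\<zero>}"
  proof (intro equalityI subsetI)
    fix x assume "x \<in> (c <#\<^bsub>R\<^esub> E) \<inter> S'"
    then obtain e where e: "e \<in> E" "x = c \<otimes> e" "x \<in> S'" by (auto simp: l_coset_eq_image)
    have ec: "e \<in> carrier R" using e E'(1) by auto
    have "e = \<zero>"
    proof (rule ccontr)
      assume "e \<noteq> \<zero>"
      \<comment> \<open>Dividing \<open>x = c e\<close> by the scalar \<open>e\<close> of
        \<open>K(b)\<close> recovers \<open>c\<close>.\<close>
      hence "inv e \<otimes> x \<in> S'" using subfield_m_inv(1)[OF E] e subalgebraE(4)[OF S'E] by auto
      moreover have "inv e \<otimes> x = c"
        using e ec c \<open>e \<noteq> \<zero>\<close> subfield_m_inv(3)[OF E, of e] m_lcomm[of "inv e" c e] field_Units by auto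
      ultimately show False using S'(6) by simp
    qed
    thus "x \<in> {\<zero>}" using e c by simp
  next
    fix x assume "x \<in> {\<zero>}"
    thus "x \<in> (c <#\<^bsub>R\<^esub> E) \<inter> S'"
      using subalgebraE(2)[OF S'(1)] c E'(2) by (force simp: l_coset_eq_image)
  qed
  let ?C = "c <#\<^bsub>R\<^esub> ?P m"
  have C: "subalgebra K ?C R" using subalgebra_l_coset[OF c(1) P] .
  have "?P m \<subseteq> ?P t" using m_t b
    by (intro mono_Span_sublist[OF K]) auto
  hence "?C \<subseteq> c <#\<^bsub>R\<^esub> E" using Span_powers[OF b(1) t] E_def by (auto simp: l_coset_eq_image)
  hence SC: "S' \<inter> ?C = {\<zero>}"
    using cE subalgebraE(2)[OF C] subalgebraE(2)[OF S'(1)] by blast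
  have "card ?C = card (?P m)" using card_l_coset[OF c subalgebraE(1)[OF P]] .
  also have "\<dots> = card K ^ m"
    using card_dimension[OF K finite_K dimension_independent[OF independent_powers[OF b(1) t]]] m_t
    by (metis diff_zero length_map length_upt less_imp_le)
  finally have "card (S' <+>\<^bsub>R\<^esub> ?C) = card V"
    using card_set_add[OF fin K S'(1) C] SC S'(9) by simp
  moreover have "S' <+>\<^bsub>R\<^esub> ?C \<subseteq> V"
    using S'(2) cP_V[of m] subalgebraE(3)[OF V] unfolding set_add_def' by blast
  ultimately have "V = S' <+>\<^bsub>R\<^esub> ?C"
    using card_subset_eq[OF finite_subspace[OF V]] by metis
  thus ?thesis using that[OF S'E _ S'(7) m_t S'(9) cE] SC c by simp
qed

end

section \<open>The weights of the points\<close>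

lemma plane_simps [simp]:
  "carrier (plane R) = carrier R \<times> carrier R"
  "(x, y) \<oplus>\<^bsub>plane R\<^esub> (x', y') = (x \<oplus>\<^bsub>R\<^esub> x', y \<oplus>\<^bsub>R\<^esub> y')"
  "(x, y) \<otimes>\<^bsub>plane R\<^esub> (x', y') = (x \<otimes>\<^bsub>R\<^esub> x', y \<otimes>\<^bsub>R\<^esub> y')"
  "\<zero>\<^bsub>plane R\<^esub> = (\<zero>\<^bsub>R\<^esub>, \<zero>\<^bsub>R\<^esub>)"
  by (simp_all add: RDirProd_def DirProd_def monoid.defs)

lemma card_diag [simp]: "card (diag K) = card K"
  unfolding diag_def by (rule card_image) (auto simp: inj_on_def)

lemma (in ring) plane_ring: "ring (plane R)"
  by (rule RDirProd_ring[OF ring_axioms ring_axioms])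

context field
begin

text \<open>The multiplier that takes \<open>(x, y)\<close> to \<open>u\<close> is nonzero and can
  be inverted. Consequently two distinct points share only the zero vector, which is what the later
  count of vectors rests on.\<close>

lemma proj_point_eqI:
  assumes "x \<in> carrier R" "y \<in> carrier R" "u \<in> proj_point R (x, y)" "u \<noteq> (\<zero>, \<zero>)"
  shows "proj_point R u = proj_point R (x, y)"
proof -
  obtain k where k: "k \<in> carrier R" "u = (k \<otimes> x, k \<otimes> y)"
    using assms(3) by (auto simp: proj_point_def)
  hence "k \<noteq> \<zero>" using assms by auto
  hence unit: "k \<in> Units R" using k field_Units by auto
  have "(l \<otimes> x, l \<otimes> y) \<in> proj_point R u" if "l \<in> carrier R" for l
  proof -
    have "l \<otimes> z = (l \<otimes> inv k) \<otimes> (k \<otimes> z)" if "z \<in> carrier R" for z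
    proof -
      have "(l \<otimes> inv k) \<otimes> (k \<otimes> z) = l \<otimes> (inv k \<otimes> k) \<otimes> z"
        using \<open>l \<in> carrier R\<close> that k(1) unit by (simp add: m_assoc del: Units_l_inv)
      thus ?thesis using \<open>l \<in> carrier R\<close> that unit by simp
    qed
    moreover have "l \<otimes> inv k \<in> carrier R" using that unit by simp
    ultimately show ?thesis using assms(1,2) k by (auto simp: proj_point_def)
  qed
  moreover have "proj_point R u \<subseteq> proj_point R (x, y)"
    using k assms(1,2) by (auto simp: proj_point_def m_assoc[symmetric])
  ultimately show ?thesis by (auto simp: proj_point_def)
qed

lemma proj_point_infinity: "proj_point R (\<one>, \<zero>) = carrier R \<times> {\<zero>}"
  by (force simp: proj_point_def)

lemma proj_point_affine: "proj_point R (x, \<one>) = {(l \<otimes> x, l) | l. l \<in> carrier R}"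
  by (force simp: proj_point_def)

lemma inj_proj_point_affine:
  assumes "x \<in> carrier R" "y \<in> carrier R" "proj_point R (x, \<one>) = proj_point R (y, \<one>)"
  shows "x = y"
proof -
  have "(x, \<one>) \<in> proj_point R (y, \<one>)"
    unfolding assms(3)[symmetric] using assms(1) by (force simp: proj_point_affine)
  thus ?thesis using assms by (auto simp: proj_point_affine)
qed

lemma subalgebra_proj_point:
  assumes "subfield K R" "x \<in> carrier R" "y \<in> carrier R"
  shows "subalgebra (diag K) (proj_point R (x, y)) (plane R)"
proof -
  have Kc: "k \<in> carrier R" if "k \<in> K" for k using subfieldE(3)[OF assms(1)] that by auto
  show ?thesis
  proof (rule ring.subalgebraI[OF plane_ring _ _ _ _ diag_subfield[OF assms(1)]])
    show "proj_point R (x, y) \<subseteq> carrier (plane R)" using assms by (auto simp: proj_point_def)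
    show "\<zero>\<^bsub>plane R\<^esub> \<in> proj_point R (x, y)"
      using assms by (auto simp: proj_point_def intro!: exI[of _ \<zero>])
    show "v \<oplus>\<^bsub>plane R\<^esub> w \<in> proj_point R (x, y)"
      if "v \<in> proj_point R (x, y)" "w \<in> proj_point R (x, y)" for v w
    proof -
      from that obtain k l where "k \<in> carrier R" "l \<in> carrier R"
          "v = (k \<otimes> x, k \<otimes> y)" "w = (l \<otimes> x, l \<otimes> y)"
        by (auto simp: proj_point_def)
      thus ?thesis using assms by (auto simp: proj_point_def l_distr intro!: exI[of _ "k \<oplus> l"])
    qed
    show "k \<otimes>\<^bsub>plane R\<^esub> v \<in> proj_point R (x, y)"
      if "k \<in> diag K" "v \<in> proj_point R (x, y)" for k v
    proof -
      from that obtain k' l where "k' \<in> K" "l \<in> carrier R" "k = (k', k')" "v = (l \<otimes> x, l \<otimes> y)"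
        by (auto simp: proj_point_def diag_def)
      thus ?thesis using assms Kc by (auto simp: proj_point_def m_assoc intro!: exI[of _ "k' \<otimes> l"])
    qed
  qed
qed

end

text \<open>Dimensions enter as cardinalities, to suit the counting. The assumption
  \<open>\<one> \<in> S\<close> makes \<open>K\<close> a subset of \<open>S\<close>.\<close>

locale club_setup = finite_extension +
  fixes S a b n
  assumes card_carrier: "card (carrier R) = card K ^ n" and n: "n \<ge> 5"
    and S: "subalgebra K S R" and card_S: "card S = card K ^ (n - 2)" and one_S: "\<one> \<in> S"
    and a: "a \<in> carrier R" "a \<notin> S" and b: "b \<in> carrier R" "b \<notin> K"
begin

section \<open>The subspace \<open>U\<close> in explicit coordinates\<close>

definition U :: "('a \<times> 'a) set"
  where "U = {(s \<oplus> \<alpha> \<oplus> \<beta> \<otimes> a, \<alpha> \<oplus> \<beta> \<otimes> b) | s \<alpha> \<beta>. s \<in> S \<and> \<alpha> \<in> K \<and> \<beta> \<in> K}"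

lemma KD: "k \<in> K \<Longrightarrow> k \<in> carrier R"
  using K_carrier by auto

lemma SD: "s \<in> S \<Longrightarrow> s \<in> carrier R"
  using subalgebraE(1)[OF S] by auto

lemma K_subset_S: "k \<in> K \<Longrightarrow> k \<in> S"
  using subalgebraE(4)[OF S _ one_S] KD by fastforce

lemmas K_closed = subringE(2,3,5,6,7)[OF subfieldE(1)[OF K]]

lemma K_minus_closed: "k \<in> K \<Longrightarrow> l \<in> K \<Longrightarrow> k \<ominus> l \<in> K"
  using K_closed by (auto simp: a_minus_def)

lemma b_not_zero: "b \<noteq> \<zero>"
  using b K_closed by auto

text \<open>A nonzero difference \<open>\<beta> \<ominus> \<beta>'\<close> could be inverted in
  \<open>K\<close>, and solving for \<open>b\<close> would put \<open>b\<close> into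
  \<open>K\<close>.\<close>

lemma coordinates_unique:
  assumes "\<alpha> \<in> K" "\<beta> \<in> K" "\<alpha>' \<in> K" "\<beta>' \<in> K" "\<alpha> \<oplus> \<beta> \<otimes> b = \<alpha>' \<oplus> \<beta>' \<otimes> b"
  shows "\<alpha> = \<alpha>' \<and> \<beta> = \<beta>'"
proof -
  note c = assms(1-4)[THEN KD] b(1)
  have "(\<beta> \<ominus> \<beta>') \<otimes> b = (\<alpha> \<oplus> \<beta> \<otimes> b) \<ominus> \<beta>' \<otimes> b \<ominus> \<alpha>" using c by algebra
  also have "\<dots> = \<alpha>' \<ominus> \<alpha>" unfolding assms(5) using c by algebra
  finally have eq: "(\<beta> \<ominus> \<beta>') \<otimes> b = \<alpha>' \<ominus> \<alpha>" .
  have "\<beta> \<ominus> \<beta>' = \<zero>"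
  proof (rule ccontr)
    assume ne: "\<beta> \<ominus> \<beta>' \<noteq> \<zero>"
    have d: "\<beta> \<ominus> \<beta>' \<in> K - {\<zero>}" using ne K_minus_closed assms by auto
    have i: "inv (\<beta> \<ominus> \<beta>') \<in> K" "inv (\<beta> \<ominus> \<beta>') \<otimes> (\<beta> \<ominus> \<beta>') = \<one>"
      using subfield_m_inv[OF K d] by auto
    have "b = inv (\<beta> \<ominus> \<beta>') \<otimes> ((\<beta> \<ominus> \<beta>') \<otimes> b)"
      using i(2) c KD[OF i(1)] by (metis m_assoc l_one minus_closed)
    also have "\<dots> \<in> K" unfolding eq using K_closed(4)[OF i(1)] K_minus_closed assms by auto
    finally show False using b by simp
  qed
  hence "\<beta> = \<beta>'" using c by simp
  thus ?thesis using assms(5) c by simp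
qed

lemma U_I:
  "s \<in> S \<Longrightarrow> \<alpha> \<in> K \<Longrightarrow> \<beta> \<in> K \<Longrightarrow> (s \<oplus> \<alpha> \<oplus> \<beta> \<otimes> a, \<alpha> \<oplus> \<beta> \<otimes> b) \<in> U"
  unfolding U_def by blast

text \<open>The summand \<open>\<alpha>\<close> of the first coordinate is absorbed by
  \<open>S\<close>, since \<open>K\<close> is contained in \<open>S\<close>. Only the coefficient
  \<open>\<beta>\<close> has to be corrected for.\<close>

lemma U_iff:
  "(x, y) \<in> U \<longleftrightarrow> x \<in> carrier R \<and> (\<exists>\<alpha> \<in> K. \<exists>\<beta> \<in> K. y = \<alpha> \<oplus> \<beta> \<otimes> b \<and> x \<ominus> \<beta> \<otimes> a \<in> S)"
proof
  assume "(x, y) \<in> U"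
  then obtain s \<alpha> \<beta> where *: "s \<in> S" "\<alpha> \<in> K" "\<beta> \<in> K" "x = s \<oplus> \<alpha> \<oplus> \<beta> \<otimes> a" "y = \<alpha> \<oplus> \<beta> \<otimes> b"
    by (auto simp: U_def)
  note c = SD[OF *(1)] KD[OF *(2)] KD[OF *(3)] a(1)
  have "x \<ominus> \<beta> \<otimes> a = s \<oplus> \<alpha>" unfolding *(4) using c by algebra
  moreover have "s \<oplus> \<alpha> \<in> S" using * K_subset_S subalgebraE(3)[OF S] by auto
  ultimately have "x \<ominus> \<beta> \<otimes> a \<in> S" by simp
  moreover have "x \<in> carrier R" unfolding *(4) using c by simp
  ultimately show "x \<in> carrier R \<and> (\<exists>\<alpha> \<in> K. \<exists>\<beta> \<in> K. y = \<alpha> \<oplus> \<beta> \<otimes> b \<and> x \<ominus> \<beta> \<otimes> a \<in> S)"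
    using *(2,3,5) by blast
next
  assume "x \<in> carrier R \<and> (\<exists>\<alpha> \<in> K. \<exists>\<beta> \<in> K. y = \<alpha> \<oplus> \<beta> \<otimes> b \<and> x \<ominus> \<beta> \<otimes> a \<in> S)"
  then obtain \<alpha> \<beta> where *: "x \<in> carrier R" "\<alpha> \<in> K" "\<beta> \<in> K" "y = \<alpha> \<oplus> \<beta> \<otimes> b" "x \<ominus> \<beta> \<otimes> a \<in> S"
    by blast
  note c = *(1) KD[OF *(2)] KD[OF *(3)] a(1)
  have "x = (x \<ominus> \<beta> \<otimes> a \<ominus> \<alpha>) \<oplus> \<alpha> \<oplus> \<beta> \<otimes> a" using c by algebra
  moreover have "x \<ominus> \<beta> \<otimes> a \<ominus> \<alpha> \<in> S" using * K_subset_S subalgebraE(6)[OF S] by auto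
  ultimately show "(x, y) \<in> U" unfolding U_def using *(2,3,4) by blast
qed

lemma subalgebra_U: "subalgebra (diag K) U (plane R)"
proof (rule ring.subalgebraI[OF plane_ring _ _ _ _ diag_subfield[OF K]])
  show "U \<subseteq> carrier (plane R)" using a b KD SD by (auto simp: U_def)
  show "\<zero>\<^bsub>plane R\<^esub> \<in> U"
    using K_closed(1) subalgebraE(2)[OF S] a b KD by (auto simp: U_def intro!: exI[of _ \<zero>])
  show "v \<oplus>\<^bsub>plane R\<^esub> w \<in> U" if "v \<in> U" "w \<in> U" for v w
  proof -
    from that obtain s \<alpha> \<beta> s' \<alpha>' \<beta>' where *: "s \<in> S" "\<alpha> \<in> K" "\<beta> \<in> K" "s' \<in> S" "\<alpha>' \<in> K" "\<beta>' \<in> K"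
        and vw: "v = (s \<oplus> \<alpha> \<oplus> \<beta> \<otimes> a, \<alpha> \<oplus> \<beta> \<otimes> b)" "w = (s' \<oplus> \<alpha>' \<oplus> \<beta>' \<otimes> a, \<alpha>' \<oplus> \<beta>' \<otimes> b)"
      by (auto simp: U_def)
    note c = SD[OF *(1)] KD[OF *(2)] KD[OF *(3)] SD[OF *(4)] KD[OF *(5)] KD[OF *(6)] a(1) b(1)
    have "(s \<oplus> \<alpha> \<oplus> \<beta> \<otimes> a) \<oplus> (s' \<oplus> \<alpha>' \<oplus> \<beta>' \<otimes> a) = (s \<oplus> s') \<oplus> (\<alpha> \<oplus> \<alpha>') \<oplus> (\<beta> \<oplus> \<beta>') \<otimes> a"
      using c by algebra
    moreover have "(\<alpha> \<oplus> \<beta> \<otimes> b) \<oplus> (\<alpha>' \<oplus> \<beta>' \<otimes> b) = (\<alpha> \<oplus> \<alpha>') \<oplus> (\<beta> \<oplus> \<beta>') \<otimes> b"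
      using c by algebra
    ultimately show ?thesis
      unfolding vw plane_simps
      using U_I[OF subalgebraE(3)[OF S *(1,4)] K_closed(5)[OF *(2,5)] K_closed(5)[OF *(3,6)]] by simp
  qed
  show "k \<otimes>\<^bsub>plane R\<^esub> v \<in> U" if "k \<in> diag K" "v \<in> U" for k v
  proof -
    from that obtain l s \<alpha> \<beta> where *: "l \<in> K" "s \<in> S" "\<alpha> \<in> K" "\<beta> \<in> K"
        and kv: "k = (l, l)" "v = (s \<oplus> \<alpha> \<oplus> \<beta> \<otimes> a, \<alpha> \<oplus> \<beta> \<otimes> b)"
      by (auto simp: U_def diag_def)
    note c = KD[OF *(1)] SD[OF *(2)] KD[OF *(3)] KD[OF *(4)] a(1) b(1)
    have "l \<otimes> (s \<oplus> \<alpha> \<oplus> \<beta> \<otimes> a) = (l \<otimes> s) \<oplus> (l \<otimes> \<alpha>) \<oplus> (l \<otimes> \<beta>) \<otimes> a" using c by algebra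
    moreover have "l \<otimes> (\<alpha> \<oplus> \<beta> \<otimes> b) = (l \<otimes> \<alpha>) \<oplus> (l \<otimes> \<beta>) \<otimes> b" using c by algebra
    ultimately show ?thesis
      unfolding kv plane_simps
      using U_I[OF subalgebraE(4)[OF S *(1,2)] K_closed(4)[OF *(1,3)] K_closed(4)[OF *(1,4)]] by simp
  qed
qed

lemma finite_plane: "finite (carrier (plane R))"
  using fin by simp

lemma finite_U: "finite U"
  using finite_subset[OF ring.subalgebra_in_carrier[OF plane_ring subalgebra_U] finite_plane] .

text \<open>The second coordinate of a vector determines \<open>\<alpha>\<close> and
  \<open>\<beta>\<close>, and the first one then determines \<open>s\<close>.\<close>

lemma card_U: "card U = card K ^ n"
proof -
  let ?f = "\<lambda>(s, \<alpha>, \<beta>). (s \<oplus> \<alpha> \<oplus> \<beta> \<otimes> a, \<alpha> \<oplus> \<beta> \<otimes> b)"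
  have img: "U = ?f ` (S \<times> K \<times> K)"
    unfolding U_def by force
  have "inj_on ?f (S \<times> K \<times> K)"
  proof (rule inj_onI)
    fix p p' assume p: "p \<in> S \<times> K \<times> K" "p' \<in> S \<times> K \<times> K" "?f p = ?f p'"
    obtain s \<alpha> \<beta> s' \<alpha>' \<beta>' where pp: "p = (s, \<alpha>, \<beta>)" "p' = (s', \<alpha>', \<beta>')"
      by (cases p, cases p')
    have *: "s \<in> S" "\<alpha> \<in> K" "\<beta> \<in> K" "s' \<in> S" "\<alpha>' \<in> K" "\<beta>' \<in> K"
      and eq: "s \<oplus> \<alpha> \<oplus> \<beta> \<otimes> a = s' \<oplus> \<alpha>' \<oplus> \<beta>' \<otimes> a" "\<alpha> \<oplus> \<beta> \<otimes> b = \<alpha>' \<oplus> \<beta>' \<otimes> b"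
      using p unfolding pp by auto
    have "\<alpha> = \<alpha>' \<and> \<beta> = \<beta>'" using coordinates_unique * eq(2) by blast
    thus "p = p'" using eq(1) * KD SD a by (auto simp: pp)
  qed
  hence "card U = card K ^ (n - 2) * (card K * card K)"
    unfolding img by (simp add: card_image card_cartesian_product card_S)
  also have "\<dots> = card K ^ (n - 2 + 2)" by (simp add: power_add power2_eq_square)
  also have "n - 2 + 2 = n" using n by simp
  finally show ?thesis .
qed

lemma dimension_U: "ring.dimension (plane R) n (diag K) U"
  using ring.dimension_iff_card[OF plane_ring finite_plane diag_subfield[OF K]] subalgebra_U card_U
  by simp

text \<open>From here on weights are found by counting the vectors of \<open>U\<close> on a
  point.\<close>

lemma card_inter_proj_point:
  assumes "x \<in> carrier R" "y \<in> carrier R"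
  shows "card (U \<inter> proj_point R (x, y)) = card K ^ weight R K U (proj_point R (x, y))"
proof -
  let ?V = "U \<inter> proj_point R (x, y)"
  have "subalgebra (diag K) ?V (plane R)"
    using ring.subalgebra_inter[OF plane_ring subalgebra_U subalgebra_proj_point[OF K assms]] .
  then obtain k where k: "ring.dimension (plane R) k (diag K) ?V"
    using ring.subalgebra_imp_dimension[OF plane_ring finite_plane diag_subfield[OF K]] by blast
  have "weight R K U (proj_point R (x, y)) = k"
    unfolding weight_def using ring.dimI[OF plane_ring diag_subfield[OF K] k] .
  thus ?thesis
    using k ring.dimension_iff_card[OF plane_ring finite_plane diag_subfield[OF K]] by simp
qed

section \<open>The point \<open>\<langle>(1, 0)\<rangle>\<close> and the affine points
  \<open>\<langle>(x, 1)\<rangle>\<close>\<close>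

lemma power_card_K_inject: "card K ^ i = card K ^ j \<longleftrightarrow> i = j"
  using card_K by (simp add: power_inject_exp)

text \<open>A zero second coordinate forces \<open>\<alpha> = \<beta> = \<zero>\<close>, so this
  point meets \<open>U\<close> exactly in \<open>S \<times> {\<zero>}\<close>.\<close>

lemma infinity_point:
  "proj_point R (\<one>, \<zero>) \<in> linear_set R U" "weight R K U (proj_point R (\<one>, \<zero>)) = n - 2"
  "card (U \<inter> proj_point R (\<one>, \<zero>)) = card K ^ (n - 2)"
proof -
  have iff: "(x, \<zero>) \<in> U \<longleftrightarrow> x \<in> S" for x
  proof
    assume "(x, \<zero>) \<in> U"
    then obtain \<alpha> \<beta> where *: "x \<in> carrier R" "\<alpha> \<in> K" "\<beta> \<in> K" "\<zero> = \<alpha> \<oplus> \<beta> \<otimes> b" "x \<ominus> \<beta> \<otimes> a \<in> S"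
      by (auto simp: U_iff)
    have "\<alpha> \<oplus> \<beta> \<otimes> b = \<zero> \<oplus> \<zero> \<otimes> b" using *(4)[symmetric] b(1) by simp
    hence "\<beta> = \<zero>" using coordinates_unique[OF *(2,3) K_closed(1) K_closed(1)] by blast
    thus "x \<in> S" using *(1,5) a(1) by (simp add: a_minus_def)
  next
    assume "x \<in> S"
    thus "(x, \<zero>) \<in> U"
      using SD K_closed(1) a b by (auto simp: U_iff a_minus_def intro!: bexI[of _ \<zero>])
  qed
  have "U \<inter> proj_point R (\<one>, \<zero>) = S \<times> {\<zero>}"
    using iff SD by (auto simp: proj_point_infinity)
  thus card: "card (U \<inter> proj_point R (\<one>, \<zero>)) = card K ^ (n - 2)"
    using card_S by (simp add: card_cartesian_product)
  thus "weight R K U (proj_point R (\<one>, \<zero>)) = n - 2"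
    using card_inter_proj_point[of \<one> \<zero>] power_card_K_inject by simp
  show "proj_point R (\<one>, \<zero>) \<in> linear_set R U"
    unfolding linear_set_def using iff one_S by auto
qed

lemma affine_pointE:
  assumes "P \<in> linear_set R U" "P \<noteq> proj_point R (\<one>, \<zero>)"
  obtains x where "x \<in> carrier R" "P = proj_point R (x, \<one>)"
proof -
  obtain x y where xy: "(x, y) \<in> U" "(x, y) \<noteq> (\<zero>, \<zero>)" "P = proj_point R (x, y)"
    using assms(1) by (auto simp: linear_set_def)
  have c: "x \<in> carrier R" "y \<in> carrier R"
    using xy(1) ring.subalgebra_in_carrier[OF plane_ring subalgebra_U] by auto
  have "y \<noteq> \<zero>"
  proof
    assume "y = \<zero>"
    hence "(x, y) \<in> proj_point R (\<one>, \<zero>)" using c by (simp add: proj_point_infinity)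
    thus False using proj_point_eqI[of \<one> \<zero> "(x, y)"] xy assms(2) by simp
  qed
  hence y: "y \<in> Units R" using c field_Units by auto
  have "(x, y) \<in> proj_point R (inv y \<otimes> x, \<one>)"
  proof -
    have "x = y \<otimes> (inv y \<otimes> x)" using c y by (simp flip: m_assoc)
    thus ?thesis using c y unfolding proj_point_def by auto
  qed
  hence "P = proj_point R (inv y \<otimes> x, \<one>)"
    using proj_point_eqI[of "inv y \<otimes> x" \<one> "(x, y)"] xy c y by simp
  thus ?thesis using that[of "inv y \<otimes> x"] c y by simp
qed

text \<open>A multiple \<open>(l x, l)\<close> can lie in \<open>U\<close> only if
  \<open>l = \<alpha> + \<beta> b\<close>. Indexing the intersection by pairs from
  \<open>K \<times> K\<close> bounds the weight by 2.\<close>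

lemma affine_inter:
  assumes "x \<in> carrier R"
  shows "U \<inter> proj_point R (x, \<one>)
    = (\<lambda>(\<alpha>, \<beta>). ((\<alpha> \<oplus> \<beta> \<otimes> b) \<otimes> x, \<alpha> \<oplus> \<beta> \<otimes> b)) `
        {(\<alpha>, \<beta>) \<in> K \<times> K. (\<alpha> \<oplus> \<beta> \<otimes> b) \<otimes> x \<ominus> \<beta> \<otimes> a \<in> S}"
proof -
  have "(\<alpha> \<oplus> \<beta> \<otimes> b) \<in> carrier R" if "\<alpha> \<in> K" "\<beta> \<in> K" for \<alpha> \<beta>
    using that KD b by simp
  thus ?thesis
    using assms unfolding proj_point_affine by (fastforce simp: U_iff image_iff)
qed

lemma inj_affine:
  "inj_on (\<lambda>(\<alpha>, \<beta>). ((\<alpha> \<oplus> \<beta> \<otimes> b) \<otimes> x, \<alpha> \<oplus> \<beta> \<otimes> b)) (K \<times> K)"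
  using coordinates_unique by (auto intro!: inj_onI)

lemma affine_weight_le:
  assumes "x \<in> carrier R"
  shows "weight R K U (proj_point R (x, \<one>)) \<le> 2"
proof -
  have "card (U \<inter> proj_point R (x, \<one>)) \<le> card (K \<times> K)"
    unfolding affine_inter[OF assms] using finite_K
    by (intro order_trans[OF card_image_le] card_mono) (auto intro: finite_subset[of _ "K \<times> K"])
  hence "card K ^ weight R K U (proj_point R (x, \<one>)) \<le> card K ^ 2"
    using card_inter_proj_point[OF assms one_closed] by (simp add: card_cartesian_product power2_eq_square)
  moreover have "1 < card K" using card_K by simp
  ultimately show ?thesis using power_le_imp_le_exp by blast
qed

text \<open>Weight 2 means that every pair \<open>(\<alpha>, \<beta>)\<close> is admissible. By
  linearity it is enough to test \<open>(\<one>, \<zero>)\<close> and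
  \<open>(\<zero>, \<one>)\<close>, which give the two conditions.\<close>

lemma affine_weight_2_iff:
  assumes "x \<in> carrier R"
  shows "weight R K U (proj_point R (x, \<one>)) = 2 \<longleftrightarrow> x \<in> S \<and> b \<otimes> x \<ominus> a \<in> S"
proof -
  let ?A = "{(\<alpha>, \<beta>) \<in> K \<times> K. (\<alpha> \<oplus> \<beta> \<otimes> b) \<otimes> x \<ominus> \<beta> \<otimes> a \<in> S}"
  have "card (U \<inter> proj_point R (x, \<one>)) = card ?A"
    unfolding affine_inter[OF assms] by (rule card_image[OF inj_on_subset[OF inj_affine]]) auto
  hence "weight R K U (proj_point R (x, \<one>)) = 2 \<longleftrightarrow> card ?A = card (K \<times> K)"
    unfolding card_inter_proj_point[OF assms one_closed] card_cartesian_product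
    using power_card_K_inject[of _ 2, unfolded power2_eq_square] by metis
  also have "\<dots> \<longleftrightarrow> ?A = K \<times> K"
    using card_subset_eq[of "K \<times> K" ?A] finite_K by auto
  also have "\<dots> \<longleftrightarrow> x \<in> S \<and> b \<otimes> x \<ominus> a \<in> S"
  proof
    assume A: "?A = K \<times> K"
    have "(\<one>, \<zero>) \<in> ?A" "(\<zero>, \<one>) \<in> ?A" unfolding A using K_closed by auto
    thus "x \<in> S \<and> b \<otimes> x \<ominus> a \<in> S" using assms a b by (simp add: a_minus_def)
  next
    assume x: "x \<in> S \<and> b \<otimes> x \<ominus> a \<in> S"
    have "(\<alpha> \<oplus> \<beta> \<otimes> b) \<otimes> x \<ominus> \<beta> \<otimes> a \<in> S" if "\<alpha> \<in> K" "\<beta> \<in> K" for \<alpha> \<beta>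
    proof -
      have "(\<alpha> \<oplus> \<beta> \<otimes> b) \<otimes> x \<ominus> \<beta> \<otimes> a = \<alpha> \<otimes> x \<oplus> \<beta> \<otimes> (b \<otimes> x \<ominus> a)"
        using KD[OF that(1)] KD[OF that(2)] assms a(1) b(1) by algebra
      thus ?thesis using subalgebraE(3,4)[OF S] x that by simp
    qed
    thus "?A = K \<times> K" by auto
  qed
  finally show ?thesis .
qed

lemma linear_set_weight_pos:
  assumes "P \<in> linear_set R U"
  shows "weight R K U P > 0"
proof (rule ccontr)
  assume "\<not> weight R K U P > 0"
  obtain x y where xy: "(x, y) \<in> U" "(x, y) \<noteq> (\<zero>, \<zero>)" "P = proj_point R (x, y)"
    using assms(1) by (auto simp: linear_set_def)
  have c: "x \<in> carrier R" "y \<in> carrier R"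
    using xy(1) ring.subalgebra_in_carrier[OF plane_ring subalgebra_U] by auto
  have "card (U \<inter> P) = 1"
    using card_inter_proj_point[OF c] xy(3) \<open>\<not> weight R K U P > 0\<close> by simp
  moreover have "{(x, y), (\<zero>, \<zero>)} \<subseteq> U \<inter> P"
    using ring.subalgebraE(2)[OF plane_ring subalgebra_U] xy
      ring.subalgebraE(2)[OF plane_ring subalgebra_proj_point[OF K c]] c
    by (auto simp: proj_point_def intro!: exI[of _ \<one>])
  ultimately show False using xy(2) by (metis card_1_singletonE insert_subset singletonD)
qed

lemma linear_set_weight_cases:
  assumes "P \<in> linear_set R U" "P \<noteq> proj_point R (\<one>, \<zero>)"
  shows "weight R K U P = 1 \<or> weight R K U P = 2"
  using affine_pointE[OF assms] affine_weight_le linear_set_weight_pos[OF assms(1)]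
  by (metis One_nat_def Suc_1 le_SucE le_zero_eq less_irrefl)

section \<open>Counting the points\<close>

lemma finite_linear_set: "finite (linear_set R U)"
  unfolding linear_set_def using finite_U by simp

lemma card_weight_2:
  "card {P \<in> linear_set R U. weight R K U P = 2} = card {x \<in> S. b \<otimes> x \<ominus> a \<in> S}"
proof -
  have "bij_betw (\<lambda>x. proj_point R (x, \<one>)) {x \<in> S. b \<otimes> x \<ominus> a \<in> S}
      {P \<in> linear_set R U. weight R K U P = 2}"
  proof (rule bij_betw_imageI)
    show "inj_on (\<lambda>x. proj_point R (x, \<one>)) {x \<in> S. b \<otimes> x \<ominus> a \<in> S}"
      using inj_proj_point_affine SD by (auto intro!: inj_onI)
    show "(\<lambda>x. proj_point R (x, \<one>)) ` {x \<in> S. b \<otimes> x \<ominus> a \<in> S} = {P \<in> linear_set R U. weight R K U P = 2}"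
    proof (intro equalityI subsetI)
      fix P assume "P \<in> (\<lambda>x. proj_point R (x, \<one>)) ` {x \<in> S. b \<otimes> x \<ominus> a \<in> S}"
      then obtain x where x: "x \<in> S" "b \<otimes> x \<ominus> a \<in> S" "P = proj_point R (x, \<one>)" by auto
      have "\<one> = \<one> \<oplus> \<zero> \<otimes> b" "x \<ominus> \<zero> \<otimes> a \<in> S"
        using x(1) SD a b by (simp_all add: a_minus_def)
      hence "(x, \<one>) \<in> U" unfolding U_iff using SD[OF x(1)] K_closed(1,2) by blast
      moreover have "(x, \<one>) \<noteq> \<zero>\<^bsub>plane R\<^esub>" by simp
      ultimately have "P \<in> linear_set R U" unfolding x(3) linear_set_def by blast
      thus "P \<in> {P \<in> linear_set R U. weight R K U P = 2}" using x affine_weight_2_iff SD by auto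
    next
      fix P assume P: "P \<in> {P \<in> linear_set R U. weight R K U P = 2}"
      \<comment> \<open>As \<open>n \<ge> 5\<close>, the weight \<open>n - 2\<close> of that point
        is not 2.\<close>
      hence "P \<noteq> proj_point R (\<one>, \<zero>)" using infinity_point(2) n by auto
      then obtain x where "x \<in> carrier R" "P = proj_point R (x, \<one>)" using affine_pointE P by blast
      thus "P \<in> (\<lambda>x. proj_point R (x, \<one>)) ` {x \<in> S. b \<otimes> x \<ominus> a \<in> S}"
        using P affine_weight_2_iff by auto
    qed
  qed
  thus ?thesis by (rule bij_betw_same_card[symmetric])
qed

text \<open>The points partition the nonzero vectors of \<open>U\<close>, and a point of weight
  \<open>w\<close> holds \<open>q^w - 1\<close> of them, where \<open>q = card K\<close>. With one
  point of weight \<open>n - 2\<close> and all others of weight 1 or 2, the resulting equation can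
  be divided by \<open>q - 1\<close>. Integers are used because the correction term is
  subtracted.\<close>

lemma card_linear_set:
  "int (card (linear_set R U)) = int (card K) ^ (n - 1) + int (card K) ^ (n - 2)
     - int (card K) * int (card {P \<in> linear_set R U. weight R K U P = 2}) + 1"
proof -
  let ?L = "linear_set R U" and ?P0 = "proj_point R (\<one>, \<zero>)" and ?o = "(\<zero>, \<zero>)"
  define L1 where "L1 = {P \<in> ?L. P \<noteq> ?P0 \<and> weight R K U P = 1}"
  define L2 where "L2 = {P \<in> ?L. weight R K U P = 2}"
  have L: "?L = insert ?P0 (L1 \<union> L2)"
    using infinity_point(1) linear_set_weight_cases unfolding L1_def L2_def by auto
  have disj: "?P0 \<notin> L1 \<union> L2" "L1 \<inter> L2 = {}"
    using infinity_point(2) n by (auto simp: L1_def L2_def)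
  have finL: "finite L1" "finite L2" using finite_linear_set by (auto simp: L1_def L2_def)
  have point: "\<exists>x y. x \<in> carrier R \<and> y \<in> carrier R \<and> P = proj_point R (x, y)" if "P \<in> ?L" for P
  proof -
    from that obtain x y where "(x, y) \<in> U" "P = proj_point R (x, y)" by (auto simp: linear_set_def)
    thus ?thesis using ring.subalgebra_in_carrier[OF plane_ring subalgebra_U] by auto
  qed
  have o_in: "?o \<in> U \<inter> P" if "P \<in> ?L" for P
    using point[OF that] ring.subalgebraE(2)[OF plane_ring subalgebra_U]
      ring.subalgebraE(2)[OF plane_ring subalgebra_proj_point[OF K]] by auto
  have part: "U - {?o} = (\<Union>P \<in> ?L. U \<inter> P - {?o})"
  proof (intro equalityI subsetI)
    fix u assume u: "u \<in> U - {?o}"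
    hence "u \<in> carrier R \<times> carrier R" using ring.subalgebra_in_carrier[OF plane_ring subalgebra_U] by auto
    hence "u \<in> proj_point R u" by (auto simp: proj_point_def intro!: exI[of _ \<one>])
    thus "u \<in> (\<Union>P \<in> ?L. U \<inter> P - {?o})" using u by (auto simp: linear_set_def)
  qed auto
  have "card (U - {?o}) = (\<Sum>P \<in> ?L. card (U \<inter> P - {?o}))"
    unfolding part
  proof (rule card_UN_disjoint[OF finite_linear_set])
    show "\<forall>P \<in> ?L. finite (U \<inter> P - {?o})" using finite_U by simp
    show "\<forall>P \<in> ?L. \<forall>Q \<in> ?L. P \<noteq> Q \<longrightarrow> (U \<inter> P - {?o}) \<inter> (U \<inter> Q - {?o}) = {}"
    proof (intro ballI impI)
      fix P Q assume PQ: "P \<in> ?L" "Q \<in> ?L" "P \<noteq> Q"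
      obtain x y x' y' where "x \<in> carrier R" "y \<in> carrier R" "P = proj_point R (x, y)"
          "x' \<in> carrier R" "y' \<in> carrier R" "Q = proj_point R (x', y')"
        using point[OF PQ(1)] point[OF PQ(2)] by auto
      hence "u = ?o" if "u \<in> P" "u \<in> Q" for u using proj_point_eqI[of _ _ u] that PQ(3) by metis
      thus "(U \<inter> P - {?o}) \<inter> (U \<inter> Q - {?o}) = {}" by blast
    qed
  qed
  also have "\<dots> = (\<Sum>P \<in> ?L. card K ^ weight R K U P - 1)"
  proof (rule sum.cong[OF refl])
    fix P assume P: "P \<in> ?L"
    thus "card (U \<inter> P - {?o}) = card K ^ weight R K U P - 1"
      using o_in[OF P] point[OF P] card_inter_proj_point by auto
  qed
  also have "\<dots> = (card K ^ (n - 2) - 1) + (\<Sum>P \<in> L1. card K - 1) + (\<Sum>P \<in> L2. card K ^ 2 - 1)"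
  proof -
    have "(\<Sum>P \<in> L1. card K ^ weight R K U P - 1) = (\<Sum>P \<in> L1. card K - 1)"
      by (rule sum.cong) (auto simp: L1_def)
    moreover have "(\<Sum>P \<in> L2. card K ^ weight R K U P - 1) = (\<Sum>P \<in> L2. card K ^ 2 - 1)"
      by (rule sum.cong) (auto simp: L2_def)
    ultimately show ?thesis
      unfolding L using disj finL by (simp add: sum.union_disjoint infinity_point(2))
  qed
  finally have "card K ^ n - 1 = (card K ^ (n - 2) - 1) + card L1 * (card K - 1) + card L2 * (card K ^ 2 - 1)"
    using o_in[OF infinity_point(1)] finite_U card_U by simp
  hence "int (card K ^ n - 1) = int ((card K ^ (n - 2) - 1) + card L1 * (card K - 1) + card L2 * (card K ^ 2 - 1))"
    by simp
  \<comment> \<open>These bounds turn the truncated differences of naturals into integer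
    differences.\<close>
  moreover have pos: "1 \<le> card K ^ i" "1 \<le> card K" for i using card_K by simp_all
  ultimately have eq: "int (card K) ^ n - int (card K) ^ (n - 2)
      = int (card L1) * (int (card K) - 1) + int (card L2) * (int (card K) ^ 2 - 1)"
    unfolding of_nat_add of_nat_mult of_nat_diff[OF pos(1)] of_nat_diff[OF pos(2)] of_nat_power by simp
  define Q where "Q = int (card K)"
  define r where "r = Q ^ (n - 2)"
  have "Q ^ (n - 2 + 2) = r * Q ^ 2" "Q ^ (n - 2 + 1) = r * Q"
    unfolding r_def by (simp_all only: power_add power_one_right)
  moreover have "n - 2 + 2 = n" "n - 2 + 1 = n - 1" using n by auto
  ultimately have pw: "Q ^ n = r * Q ^ 2" "Q ^ (n - 1) = r * Q" by metis+
  \<comment> \<open>Both sides are arranged to show the factor \<open>Q - 1\<close>, via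
    \<open>Q^2 - 1 = (Q - 1) (Q + 1)\<close>.\<close>
  have "(Q - 1) * (r * Q + r) = (Q - 1) * (int (card L1) + int (card L2) * (Q + 1))"
    using eq unfolding Q_def[symmetric] pw r_def[symmetric] by (simp add: algebra_simps power2_eq_square)
  moreover have "Q - 1 \<noteq> 0" using card_K by (simp add: Q_def)
  ultimately have "r * Q + r = int (card L1) + int (card L2) * (Q + 1)" by simp
  moreover have "card ?L = 1 + card L1 + card L2"
    unfolding L using disj finL by (simp add: card_Un_disjoint)
  ultimately show ?thesis
    unfolding L2_def[symmetric] Q_def[symmetric] pw r_def[symmetric] by (simp add: algebra_simps)
qed

text \<open>All points other than \<open>\<langle>(1, 0)\<rangle>\<close> have weight 1 or 2. Since
  \<open>n \<ge> 5\<close>, the value \<open>n - 2\<close> differs from both, so only points of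
  weight 2 can spoil the club.\<close>

lemma club_iff: "club R K n (n - 2) U \<longleftrightarrow> {P \<in> linear_set R U. weight R K U P = 2} = {}"
proof
  assume "club R K n (n - 2) U"
  thus "{P \<in> linear_set R U. weight R K U P = 2} = {}" using n by (fastforce simp: club_def)
next
  assume "{P \<in> linear_set R U. weight R K U P = 2} = {}"
  hence one: "weight R K U P = 1" if "P \<in> linear_set R U" "P \<noteq> proj_point R (\<one>, \<zero>)" for P
    using linear_set_weight_cases that by blast
  moreover have "\<exists>!P. P \<in> linear_set R U \<and> weight R K U P = n - 2"
  proof (rule ex1I[of _ "proj_point R (\<one>, \<zero>)"])
    show "P = proj_point R (\<one>, \<zero>)" if "P \<in> linear_set R U \<and> weight R K U P = n - 2" for P
      using one[of P] that n by (cases "P = proj_point R (\<one>, \<zero>)") auto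
  qed (use infinity_point in simp)
  ultimately show "club R K n (n - 2) U"
    unfolding club_def using dimension_U infinity_point(2) by metis
qed

text \<open>Writing \<open>a = s + b x\<close> with \<open>s\<close> and \<open>x\<close> in
  \<open>S\<close> is the same as solving \<open>b x - a \<in> S\<close>. Two solutions differ by an
  element of \<open>stable_part b S\<close>, so translation by one of them gives all.\<close>

lemma card_weight_2_eq:
  "card {P \<in> linear_set R U. weight R K U P = 2}
    = (if a \<in> S <+>\<^bsub>R\<^esub> (b <#\<^bsub>R\<^esub> S) then card (stable_part b S) else 0)"
proof (cases "\<exists>x \<in> S. b \<otimes> x \<ominus> a \<in> S")
  case True
  then obtain x where x: "x \<in> S" "b \<otimes> x \<ominus> a \<in> S" by blast
  note c = SD[OF x(1)] a(1) b(1)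
  have "a = \<ominus> (b \<otimes> x \<ominus> a) \<oplus> b \<otimes> x" using c by algebra
  hence mem: "a \<in> S <+>\<^bsub>R\<^esub> (b <#\<^bsub>R\<^esub> S)"
    unfolding set_add_mem_iff l_coset_eq_image using x subalgebraE(5)[OF S] by blast
  have "bij_betw (\<lambda>y. x \<oplus> y) (stable_part b S) {x \<in> S. b \<otimes> x \<ominus> a \<in> S}"
  proof (rule bij_betw_imageI)
    show "inj_on (\<lambda>y. x \<oplus> y) (stable_part b S)"
      using c SD by (auto intro!: inj_onI simp: stable_part_def)
    show "(\<lambda>y. x \<oplus> y) ` stable_part b S = {x \<in> S. b \<otimes> x \<ominus> a \<in> S}"
    proof (intro equalityI subsetI)
      fix z assume "z \<in> (\<lambda>y. x \<oplus> y) ` stable_part b S"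
      then obtain y where y: "y \<in> S" "b \<otimes> y \<in> S" "z = x \<oplus> y" by (auto simp: stable_part_def)
      have "b \<otimes> z \<ominus> a = (b \<otimes> x \<ominus> a) \<oplus> b \<otimes> y" unfolding y(3) using c SD[OF y(1)] by algebra
      thus "z \<in> {x \<in> S. b \<otimes> x \<ominus> a \<in> S}" using x y subalgebraE(3)[OF S] by simp
    next
      fix z assume "z \<in> {x \<in> S. b \<otimes> x \<ominus> a \<in> S}"
      hence z: "z \<in> S" "b \<otimes> z \<ominus> a \<in> S" by auto
      note c = c SD[OF z(1)]
      have "z = x \<oplus> (z \<ominus> x)" using c by algebra
      moreover have "b \<otimes> (z \<ominus> x) = (b \<otimes> z \<ominus> a) \<ominus> (b \<otimes> x \<ominus> a)" using c by algebra
      hence "z \<ominus> x \<in> stable_part b S" using x z subalgebraE(6)[OF S] by (simp add: stable_part_def)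
      ultimately show "z \<in> (\<lambda>y. x \<oplus> y) ` stable_part b S" by blast
    qed
  qed
  thus ?thesis unfolding card_weight_2 using mem bij_betw_same_card by fastforce
next
  case False
  have "a \<notin> S <+>\<^bsub>R\<^esub> (b <#\<^bsub>R\<^esub> S)"
  proof
    assume "a \<in> S <+>\<^bsub>R\<^esub> (b <#\<^bsub>R\<^esub> S)"
    then obtain s x where sx: "s \<in> S" "x \<in> S" "a = s \<oplus> b \<otimes> x"
      by (auto simp: set_add_mem_iff l_coset_eq_image)
    have "b \<otimes> x \<ominus> a = \<ominus> s" unfolding sx(3) using SD[OF sx(1)] SD[OF sx(2)] b(1) by algebra
    thus False using False sx subalgebraE(5)[OF S] by auto
  qed
  moreover have none: "{x \<in> S. b \<otimes> x \<ominus> a \<in> S} = {}" using False by blast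
  ultimately show ?thesis unfolding card_weight_2 none by simp
qed

text \<open>The stable part contains zero and so has positive size; hence points of weight 2 exist
  as soon as \<open>a\<close> is in the sum.\<close>

lemma club_iff_not_mem: "club R K n (n - 2) U \<longleftrightarrow> a \<notin> S <+>\<^bsub>R\<^esub> (b <#\<^bsub>R\<^esub> S)"
proof -
  have "card (stable_part b S) > 0" using card_subspace_pos subalgebra_stable_part S b by blast
  thus ?thesis
    unfolding club_iff using card_weight_2_eq
      card_0_eq[of "{P \<in> linear_set R U. weight R K U P = 2}"] finite_linear_set
    by (auto split: if_splits)
qed

end

section \<open>The three cases\<close>

context club_setup
begin

section \<open>The span of the products and the given form of \<open>U\<close>\<close>

abbreviation ST :: "'a set"
  where "ST \<equiv> S <+>\<^bsub>R\<^esub> (b <#\<^bsub>R\<^esub> S)"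

abbreviation E :: "'a set"
  where "E \<equiv> generate_field R (insert b K)"

lemma subalgebra_ST: "subalgebra K ST R"
  using subalgebra_set_add[OF fin K S subalgebra_l_coset[OF b(1) S]] .

lemma S_subset_ST: "S \<subseteq> ST"
proof
  fix s assume s: "s \<in> S"
  have "s = s \<oplus> b \<otimes> \<zero>" using SD[OF s] b(1) by simp
  thus "s \<in> ST" unfolding set_add_mem_iff l_coset_eq_image using s subalgebraE(2)[OF S] by blast
qed

text \<open>A product of \<open>s\<close> with \<open>\<alpha> + \<beta> b\<close> equals
  \<open>\<alpha> s + b (\<beta> s)\<close>. Conversely, \<open>\<one>\<close> and \<open>b\<close>
  themselves belong to the second factor.\<close>

lemma span_set_eq: "span_set R K (S <#>\<^bsub>R\<^esub> Span K [\<one>, b]) = ST"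
proof
  have "s \<otimes> t \<in> ST" if "s \<in> S" "t \<in> Span K [\<one>, b]" for s t
  proof -
    from that(2) obtain \<alpha> \<beta> where t: "\<alpha> \<in> K" "\<beta> \<in> K" "t = \<alpha> \<otimes> \<one> \<oplus> (\<beta> \<otimes> b \<oplus> \<zero>)"
      by (auto simp: line_extension_mem_iff)
    have "s \<otimes> t = \<alpha> \<otimes> s \<oplus> b \<otimes> (\<beta> \<otimes> s)"
      unfolding t(3) using SD[OF that(1)] KD[OF t(1)] KD[OF t(2)] b(1) by algebra
    thus ?thesis
      unfolding set_add_mem_iff l_coset_eq_image using subalgebraE(4)[OF S] that(1) t(1,2) by blast
  qed
  hence "S <#>\<^bsub>R\<^esub> Span K [\<one>, b] \<subseteq> ST" unfolding set_mult_def by blast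
  thus "span_set R K (S <#>\<^bsub>R\<^esub> Span K [\<one>, b]) \<subseteq> ST"
    unfolding span_set_def using subalgebra_ST by blast
  show "ST \<subseteq> span_set R K (S <#>\<^bsub>R\<^esub> Span K [\<one>, b])"
  proof
    fix x assume "x \<in> ST"
    then obtain s s' where x: "s \<in> S" "s' \<in> S" "x = s \<oplus> b \<otimes> s'"
      unfolding set_add_mem_iff l_coset_eq_image by blast
    have base: "\<one> \<in> Span K [\<one>, b]" "b \<in> Span K [\<one>, b]"
      using Span_base_incl[OF K, of "[\<one>, b]"] b(1) by (simp_all del: Span.simps)
    have "x = s \<otimes> \<one> \<oplus> s' \<otimes> b" using x SD b(1) by (simp add: m_comm)
    moreover have "s \<otimes> \<one> \<in> S <#>\<^bsub>R\<^esub> Span K [\<one>, b]" "s' \<otimes> b \<in> S <#>\<^bsub>R\<^esub> Span K [\<one>, b]"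
      unfolding set_mult_def using x base by blast+
    ultimately show "x \<in> span_set R K (S <#>\<^bsub>R\<^esub> Span K [\<one>, b])"
      unfolding span_set_def using subalgebraE(3) by blast
  qed
qed

text \<open>Over \<open>diag K\<close> the span of one vector consists of its multiples by
  \<open>K\<close>, so the sum of spans unfolds to the explicit parametrization.\<close>

lemma U_eq:
  "(S \<times> {\<zero>}) <+>\<^bsub>plane R\<^esub> ring.Span (plane R) (diag K) [(\<one>, \<one>)]
     <+>\<^bsub>plane R\<^esub> ring.Span (plane R) (diag K) [(a, b)] = U"
proof -
  interpret P: ring "plane R" by (rule plane_ring)
  have Span1: "P.Span (diag K) [(x, y)] = {(k \<otimes> x, k \<otimes> y) | k. k \<in> K}"
    if "x \<in> carrier R" "y \<in> carrier R" for x y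
    using that KD by (auto simp: P.line_extension_mem_iff diag_def set_eq_iff)
  have "u \<in> (S \<times> {\<zero>}) <+>\<^bsub>plane R\<^esub> P.Span (diag K) [(\<one>, \<one>)] <+>\<^bsub>plane R\<^esub> P.Span (diag K) [(a, b)]
     \<longleftrightarrow> (\<exists>s \<in> S. \<exists>\<alpha> \<in> K. \<exists>\<beta> \<in> K. u = (s \<oplus> \<alpha> \<otimes> \<one> \<oplus> \<beta> \<otimes> a, \<zero> \<oplus> \<alpha> \<otimes> \<one> \<oplus> \<beta> \<otimes> b))" for u
  proof
    assume "u \<in> (S \<times> {\<zero>}) <+>\<^bsub>plane R\<^esub> P.Span (diag K) [(\<one>, \<one>)] <+>\<^bsub>plane R\<^esub> P.Span (diag K) [(a, b)]"
    then obtain s \<alpha> \<beta> where "s \<in> S" "\<alpha> \<in> K" "\<beta> \<in> K"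
        "u = (s, \<zero>) \<oplus>\<^bsub>plane R\<^esub> (\<alpha> \<otimes> \<one>, \<alpha> \<otimes> \<one>) \<oplus>\<^bsub>plane R\<^esub> (\<beta> \<otimes> a, \<beta> \<otimes> b)"
      unfolding set_add_def' Span1[OF one_closed one_closed] Span1[OF a(1) b(1)] by blast
    thus "\<exists>s \<in> S. \<exists>\<alpha> \<in> K. \<exists>\<beta> \<in> K. u = (s \<oplus> \<alpha> \<otimes> \<one> \<oplus> \<beta> \<otimes> a, \<zero> \<oplus> \<alpha> \<otimes> \<one> \<oplus> \<beta> \<otimes> b)"
      unfolding plane_simps by blast
  next
    assume "\<exists>s \<in> S. \<exists>\<alpha> \<in> K. \<exists>\<beta> \<in> K. u = (s \<oplus> \<alpha> \<otimes> \<one> \<oplus> \<beta> \<otimes> a, \<zero> \<oplus> \<alpha> \<otimes> \<one> \<oplus> \<beta> \<otimes> b)"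
    then obtain s \<alpha> \<beta> where "s \<in> S" "\<alpha> \<in> K" "\<beta> \<in> K"
        "u = (s, \<zero>) \<oplus>\<^bsub>plane R\<^esub> (\<alpha> \<otimes> \<one>, \<alpha> \<otimes> \<one>) \<oplus>\<^bsub>plane R\<^esub> (\<beta> \<otimes> a, \<beta> \<otimes> b)"
      unfolding plane_simps by blast
    thus "u \<in> (S \<times> {\<zero>}) <+>\<^bsub>plane R\<^esub> P.Span (diag K) [(\<one>, \<one>)] <+>\<^bsub>plane R\<^esub> P.Span (diag K) [(a, b)]"
      unfolding set_add_def' Span1[OF one_closed one_closed] Span1[OF a(1) b(1)] by blast
  qed
  moreover have "(s \<oplus> \<alpha> \<otimes> \<one> \<oplus> \<beta> \<otimes> a, \<zero> \<oplus> \<alpha> \<otimes> \<one> \<oplus> \<beta> \<otimes> b) = (s \<oplus> \<alpha> \<oplus> \<beta> \<otimes> a, \<alpha> \<oplus> \<beta> \<otimes> b)"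
    if "\<alpha> \<in> K" for s \<alpha> \<beta>
    using that KD by simp
  ultimately show ?thesis unfolding U_def set_eq_iff mem_Collect_eq by metis
qed

text \<open>Common source of all descriptions of the linear set: \<open>g\<close> parametrizes
  \<open>S\<close>, and \<open>Z\<close> singles out the parameters of its zero vector. A zero
  vector of \<open>U\<close> has \<open>\<alpha> = \<beta> = \<zero>\<close> because
  \<open>\<one>\<close> and \<open>b\<close> are independent, and then
  \<open>s = \<zero>\<close>.\<close>

lemma linear_set_param:
  assumes "S = g ` A" "\<And>p. p \<in> A \<Longrightarrow> g p = \<zero> \<longleftrightarrow> Z p"
  shows "linear_set R U = {proj_point R (g p \<oplus> \<alpha> \<oplus> \<beta> \<otimes> a, \<alpha> \<oplus> \<beta> \<otimes> b)
    | p \<alpha> \<beta>. p \<in> A \<and> \<alpha> \<in> K \<and> \<beta> \<in> K \<and> \<not> (Z p \<and> \<alpha> = \<zero> \<and> \<beta> = \<zero>)}"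
proof -
  have zero: "(s \<oplus> \<alpha> \<oplus> \<beta> \<otimes> a, \<alpha> \<oplus> \<beta> \<otimes> b) = (\<zero>, \<zero>) \<longleftrightarrow> s = \<zero> \<and> \<alpha> = \<zero> \<and> \<beta> = \<zero>"
    if s: "s \<in> S" "\<alpha> \<in> K" "\<beta> \<in> K" for s \<alpha> \<beta>
  proof
    assume z: "(s \<oplus> \<alpha> \<oplus> \<beta> \<otimes> a, \<alpha> \<oplus> \<beta> \<otimes> b) = (\<zero>, \<zero>)"
    hence "\<alpha> \<oplus> \<beta> \<otimes> b = \<zero> \<oplus> \<zero> \<otimes> b" using b(1) by simp
    hence "\<alpha> = \<zero> \<and> \<beta> = \<zero>" using coordinates_unique[OF s(2,3) K_closed(1) K_closed(1)] by blast
    thus "s = \<zero> \<and> \<alpha> = \<zero> \<and> \<beta> = \<zero>" using z SD[OF s(1)] a(1) by simp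
  qed (use a(1) b(1) in simp)
  show ?thesis
  proof (intro equalityI subsetI)
    fix P assume "P \<in> linear_set R U"
    then obtain u where u: "u \<in> U" "u \<noteq> (\<zero>, \<zero>)" "P = proj_point R u"
      unfolding linear_set_def plane_simps by blast
    then obtain s \<alpha> \<beta> where s: "s \<in> S" "\<alpha> \<in> K" "\<beta> \<in> K" "u = (s \<oplus> \<alpha> \<oplus> \<beta> \<otimes> a, \<alpha> \<oplus> \<beta> \<otimes> b)"
      unfolding U_def by blast
    obtain p where p: "p \<in> A" "s = g p" using s(1) assms(1) by blast
    have "\<not> (Z p \<and> \<alpha> = \<zero> \<and> \<beta> = \<zero>)"
      using u(2) zero[OF s(1-3)] assms(2)[OF p(1)] unfolding s(4) p(2) by blast
    thus "P \<in> {proj_point R (g p \<oplus> \<alpha> \<oplus> \<beta> \<otimes> a, \<alpha> \<oplus> \<beta> \<otimes> b)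
        | p \<alpha> \<beta>. p \<in> A \<and> \<alpha> \<in> K \<and> \<beta> \<in> K \<and> \<not> (Z p \<and> \<alpha> = \<zero> \<and> \<beta> = \<zero>)}"
      unfolding u(3) s(4) p(2) using p(1) s(2,3) by blast
  next
    fix P assume "P \<in> {proj_point R (g p \<oplus> \<alpha> \<oplus> \<beta> \<otimes> a, \<alpha> \<oplus> \<beta> \<otimes> b)
        | p \<alpha> \<beta>. p \<in> A \<and> \<alpha> \<in> K \<and> \<beta> \<in> K \<and> \<not> (Z p \<and> \<alpha> = \<zero> \<and> \<beta> = \<zero>)}"
    then obtain p \<alpha> \<beta> where p: "p \<in> A" "\<alpha> \<in> K" "\<beta> \<in> K" "\<not> (Z p \<and> \<alpha> = \<zero> \<and> \<beta> = \<zero>)"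
        "P = proj_point R (g p \<oplus> \<alpha> \<oplus> \<beta> \<otimes> a, \<alpha> \<oplus> \<beta> \<otimes> b)" by blast
    have gp: "g p \<in> S" using p(1) assms(1) by blast
    have "(g p \<oplus> \<alpha> \<oplus> \<beta> \<otimes> a, \<alpha> \<oplus> \<beta> \<otimes> b) \<noteq> (\<zero>, \<zero>)"
      using zero[OF gp p(2,3)] p(4) assms(2)[OF p(1)] by blast
    thus "P \<in> linear_set R U"
      unfolding linear_set_def plane_simps p(5) using U_I[OF gp p(2,3)] by blast
  qed
qed

text \<open>The sum lies between \<open>S\<close> and the whole field, so its exponent lies between
  \<open>n - 2\<close> and \<open>n\<close>.\<close>

lemma card_ST_cases: "card ST = card K ^ n \<or> card ST = card K ^ (n - 1) \<or> card ST = card K ^ (n - 2)"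
proof -
  obtain k where k: "card ST = card K ^ k" using card_subspace[OF subalgebra_ST] by blast
  have "card K ^ (n - 2) \<le> card K ^ k"
    using card_mono[OF finite_subspace[OF subalgebra_ST] S_subset_ST] card_S k by simp
  moreover have "card K ^ k \<le> card K ^ n"
    using card_mono[OF fin subalgebraE(1)[OF subalgebra_ST]] card_carrier k by simp
  moreover have "1 < card K" using card_K by simp
  ultimately have "n - 2 \<le> k" "k \<le> n" by (blast intro: power_le_imp_le_exp)+
  hence "k = n \<or> k = n - 1 \<or> k = n - 2" by linarith
  thus ?thesis using k by auto
qed

text \<open>The product formula for \<open>S + b S\<close>, solved for the stable part; the bound on
  \<open>k\<close> keeps the exponent from being truncated.\<close>

lemma card_stable_part_S:
  assumes "card ST = card K ^ k" "k \<le> 2 * n - 4"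
  shows "card (stable_part b S) = card K ^ (2 * n - 4 - k)"
proof -
  have "card K ^ k * card (stable_part b S) = card K ^ (n - 2) * card K ^ (n - 2)"
    using card_sum_stable_part[OF b(1) b_not_zero S] assms(1) card_S by simp
  also have "\<dots> = card K ^ k * card K ^ (2 * n - 4 - k)"
  proof -
    have "n - 2 + (n - 2) = k + (2 * n - 4 - k)" using assms(2) n by simp
    thus ?thesis by (metis power_add)
  qed
  finally show ?thesis using card_K by simp
qed

section \<open>The degree of \<open>K(b)\<close> and the shape of \<open>S\<close> in the hyperplane
  case\<close>

lemma subfield_E: "subfield E R"
  using b(1) K_carrier by (intro generate_field_is_subfield) auto

text \<open>A field has at least two elements, which excludes \<open>t = 0\<close>; degree 1 would
  give \<open>K(b) = K\<close>, which does not contain \<open>b\<close>.\<close>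

lemma degree_E_ge_2:
  assumes "card E = card K ^ t"
  shows "t \<ge> 2"
proof (rule ccontr)
  assume "\<not> t \<ge> 2"
  hence t: "t = 0 \<or> t = 1" by auto
  have fE: "finite E" using finite_subset[OF subfieldE(3)[OF subfield_E] fin] .
  have "card E \<ge> 2" using subfield_card_ge_2[OF subfield_E fE] .
  hence "t = 1" using t assms by auto
  hence "K = E" using card_subset_eq[OF fE K_subset_generate_field] assms by simp
  moreover have "b \<in> E" by (auto intro: generate_field.incl)
  ultimately show False using b(2) by simp
qed

lemma degree_E_dvd:
  assumes "card E = card K ^ t" "subalgebra E V R" "card V = card K ^ k"
  obtains l where "dimension l E V" "k = t * l"
proof -
  obtain l where l: "dimension l E V"
    using subalgebra_imp_dimension[OF fin subfield_E assms(2)] by blast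
  hence "card K ^ k = (card K ^ t) ^ l"
    using dimension_iff_card[OF fin subfield_E] assms by simp
  hence "k = t * l" unfolding power_mult[symmetric] power_card_K_inject .
  thus ?thesis using that l by blast
qed

lemma carrier_subalgebra_E: "subalgebra E (carrier R) R"
  using carrier_is_subalgebra[OF subfieldE(3)[OF subfield_E]] .

text \<open>The hyperplane condition says that the stable part has codimension 1 in
  \<open>S\<close>, so the decomposition applies. Its parameters satisfy
  \<open>n - 2 = t l + m\<close>, and \<open>t\<close> divides \<open>n\<close>, so \<open>t\<close>
  divides \<open>m + 2\<close>; this pins down \<open>m\<close>.\<close>

lemma S_decomposition:
  assumes t: "card E = card K ^ t" and "card ST = card K ^ (n - 1)"
  obtains l c S' where "t \<ge> 3" "n = t * (l + 1)" "c \<in> carrier R - {\<zero>}" "subalgebra E S' R"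
    "dimension l E S'" "(c <#\<^bsub>R\<^esub> E) \<inter> S' = {\<zero>}"
    "S = S' <+>\<^bsub>R\<^esub> (c <#\<^bsub>R\<^esub> Span K (map (\<lambda>i. b [^] i) [0..<t - 2]))"
    "S' \<inter> (c <#\<^bsub>R\<^esub> Span K (map (\<lambda>i. b [^] i) [0..<t - 2])) = {\<zero>}"
proof -
  have "card (stable_part b S) = card K ^ (2 * n - 4 - (n - 1))"
    using card_stable_part_S[OF assms(2)] n by simp
  also have "2 * n - 4 - (n - 1) = n - 3" using n by simp
  finally have "card K * card (stable_part b S) = card K ^ Suc (n - 3)" by simp
  also have "Suc (n - 3) = n - 2" using n by simp
  finally have "card S = card K * card (stable_part b S)" using card_S by simp
  then obtain S' c m where S': "subalgebra E S' R" "c \<in> carrier R - {\<zero>}" "1 \<le> m" "m < t"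
    "card S = card S' * card K ^ m" "(c <#\<^bsub>R\<^esub> E) \<inter> S' = {\<zero>}"
    "S = S' <+>\<^bsub>R\<^esub> (c <#\<^bsub>R\<^esub> Span K (map (\<lambda>i. b [^] i) [0..<m]))"
    "S' \<inter> (c <#\<^bsub>R\<^esub> Span K (map (\<lambda>i. b [^] i) [0..<m])) = {\<zero>}"
    using almost_stable_decomposition[OF b(1) b_not_zero S _ t] by blast
  obtain k where k: "card S' = card K ^ k"
    using card_subspace[OF subalgebra_restrict[OF S'(1)]] by blast
  obtain l where l: "dimension l E S'" "k = t * l" using degree_E_dvd[OF t S'(1) k] .
  obtain N where N: "n = t * N" using degree_E_dvd[OF t carrier_subalgebra_E card_carrier] .
  have "card K ^ (n - 2) = card K ^ (t * l + m)"
    using S'(5) card_S k l(2) by (simp add: power_add)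
  hence "n - 2 = t * l + m" using power_card_K_inject by blast
  hence eq: "t * N = t * l + m + 2" using N n by linarith
  hence "t * l < t * N" by simp
  hence "l < N" by simp
  then obtain d where d: "N = l + d" "d \<ge> 1" using less_imp_add_positive[of l N] by auto
  hence td: "t * d = m + 2" using eq by (simp add: algebra_simps)
  \<comment> \<open>Otherwise \<open>2 t \<le> m + 2 < t + 2\<close>, so \<open>t < 2\<close>,
    against \<open>1 \<le> m < t\<close>.\<close>
  have "d < 2"
  proof (rule ccontr)
    assume "\<not> d < 2"
    hence "t * 2 \<le> t * d" by simp
    thus False using td S'(3,4) by linarith
  qed
  hence "d = 1" using d(2) by simp
  hence m: "m = t - 2" "t \<ge> 3" "n = t * (l + 1)" using td S'(3) N d by auto
  show ?thesis using that[OF m(2,3) S'(2,1) l(1) S'(6)] S'(7,8) unfolding m(1) by blast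
qed

text \<open>The coefficients \<open>x i\<close> come from a field \<open>L\<close> of their own
  while \<open>\<alpha>\<close> and \<open>\<beta>\<close> stay in \<open>K\<close>. This covers
  both \<open>L = K\<close> with the powers of \<open>b\<close> and \<open>L = K(b)\<close> with the
  powers of another generator.\<close>

lemma linear_set_full:
  assumes m: "m \<ge> 1" and c: "c \<in> carrier R - {\<zero>}" and g: "\<gamma> \<in> carrier R" and L: "subfield L R"
    and ind: "independent L (map (\<lambda>i. \<gamma> [^] i) [0..<m])"
    and S_eq: "S = c <#\<^bsub>R\<^esub> Span L (map (\<lambda>i. \<gamma> [^] i) [0..<m])"
  shows "linear_set R U = {proj_point R ((\<Oplus>i \<in> {..m - 1}. c \<otimes> x i \<otimes> \<gamma> [^] i) \<oplus> \<alpha> \<oplus> \<beta> \<otimes> a, \<alpha> \<oplus> \<beta> \<otimes> b)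
    | x \<alpha> \<beta>. x \<in> {..m - 1} \<rightarrow> L \<and> \<alpha> \<in> K \<and> \<beta> \<in> K
       \<and> \<not> ((\<forall>i \<in> {..m - 1}. x i = \<zero>) \<and> \<alpha> = \<zero> \<and> \<beta> = \<zero>)}"
proof -
  interpret L: finite_extension R L by (rule finite_extension.intro[OF field_axioms finite_extension_axioms.intro[OF fin L]])
  have c': "c \<in> carrier R" "c \<noteq> \<zero>" using c by auto
  have "S = (\<lambda>x. \<Oplus>i \<in> {..m - 1}. c \<otimes> x i \<otimes> \<gamma> [^] i) ` ({..m - 1} \<rightarrow> L)"
    unfolding S_eq L.coset_Span_powers(1)[OF g c'(1) m] by blast
  thus ?thesis
    by (rule linear_set_param) (rule L.coset_Span_powers(2)[OF g c'(1) m c'(2) ind])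
qed

text \<open>The trivial intersection makes a sum \<open>s + f\<close> vanish only when both parts
  do, so the parameters of the zero vector split into two independent conditions.\<close>

lemma linear_set_direct_sum:
  assumes m: "m \<ge> 1" and c: "c \<in> carrier R - {\<zero>}"
    and ind: "independent K (map (\<lambda>i. b [^] i) [0..<m])" and S': "subalgebra K S' R"
    and S_eq: "S = S' <+>\<^bsub>R\<^esub> (c <#\<^bsub>R\<^esub> Span K (map (\<lambda>i. b [^] i) [0..<m]))"
    and triv: "S' \<inter> (c <#\<^bsub>R\<^esub> Span K (map (\<lambda>i. b [^] i) [0..<m])) = {\<zero>}"
  shows "linear_set R U = {proj_point R (s \<oplus> (\<Oplus>i \<in> {..m - 1}. c \<otimes> x i \<otimes> b [^] i) \<oplus> \<alpha> \<oplus> \<beta> \<otimes> a, \<alpha> \<oplus> \<beta> \<otimes> b)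
    | s x \<alpha> \<beta>. s \<in> S' \<and> x \<in> {..m - 1} \<rightarrow> K \<and> \<alpha> \<in> K \<and> \<beta> \<in> K
       \<and> \<not> (s = \<zero> \<and> (\<forall>i \<in> {..m - 1}. x i = \<zero>) \<and> \<alpha> = \<zero> \<and> \<beta> = \<zero>)}"
proof -
  have c': "c \<in> carrier R" "c \<noteq> \<zero>" using c by auto
  let ?f = "\<lambda>x. \<Oplus>i \<in> {..m - 1}. c \<otimes> x i \<otimes> b [^] i"
  let ?C = "c <#\<^bsub>R\<^esub> Span K (map (\<lambda>i. b [^] i) [0..<m])"
  have C: "subalgebra K ?C R"
    using subalgebra_l_coset[OF c'(1) Span_is_subalgebra[OF K powers_carrier[OF b(1)]]] .
  have C_eq: "?C = {?f x | x. x \<in> {..m - 1} \<rightarrow> K}" using coset_Span_powers(1)[OF b(1) c'(1) m] .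
  have "S = (\<lambda>(s, x). s \<oplus> ?f x) ` (S' \<times> ({..m - 1} \<rightarrow> K))"
    unfolding S_eq C_eq set_add_def' by force
  moreover have "(\<lambda>(s, x). s \<oplus> ?f x) p = \<zero> \<longleftrightarrow> (\<lambda>(s, x). s = \<zero> \<and> (\<forall>i \<in> {..m - 1}. x i = \<zero>)) p"
    if p: "p \<in> S' \<times> ({..m - 1} \<rightarrow> K)" for p
  proof -
    obtain s x where sx: "p = (s, x)" "s \<in> S'" "x \<in> {..m - 1} \<rightarrow> K" using p by auto
    have f: "?f x \<in> ?C" unfolding C_eq using sx(3) by blast
    note car = subalgebraE(1)[OF S', THEN subsetD, OF sx(2)] subalgebraE(1)[OF C, THEN subsetD, OF f]
    have "s \<oplus> ?f x = \<zero> \<longleftrightarrow> s = \<zero> \<and> ?f x = \<zero>"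
    proof
      assume z: "s \<oplus> ?f x = \<zero>"
      hence "s = \<ominus> ?f x" using car by (metis minus_equality minus_minus)
      hence "s \<in> ?C" using subalgebraE(5)[OF C f] by (simp del: Span.simps)
      hence "s = \<zero>" using triv sx(2) by blast
      thus "s = \<zero> \<and> ?f x = \<zero>" using z car by simp
    qed simp
    thus ?thesis unfolding sx(1) prod.case coset_Span_powers(2)[OF b(1) c'(1) m c'(2) ind sx(3)] .
  qed
  ultimately have "linear_set R U = {proj_point R ((\<lambda>(s, x). s \<oplus> ?f x) p \<oplus> \<alpha> \<oplus> \<beta> \<otimes> a, \<alpha> \<oplus> \<beta> \<otimes> b)
    | p \<alpha> \<beta>. p \<in> S' \<times> ({..m - 1} \<rightarrow> K) \<and> \<alpha> \<in> K \<and> \<beta> \<in> K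
       \<and> \<not> ((\<lambda>(s, x). s = \<zero> \<and> (\<forall>i \<in> {..m - 1}. x i = \<zero>)) p \<and> \<alpha> = \<zero> \<and> \<beta> = \<zero>)}"
    by (rule linear_set_param)
  thus ?thesis by (simp only: split_paired_Ex prod.case mem_Sigma_iff conj_assoc)
qed

section \<open>The case in which \<open>S\<close> is stable under \<open>b\<close>\<close>

lemma zero_set_add: "V \<subseteq> carrier R \<Longrightarrow> {\<zero>} <+>\<^bsub>R\<^esub> V = V"
  unfolding set_add_def' by force

text \<open>Equal sizes give \<open>S + b S = S\<close>, so \<open>S\<close> is a space over
  \<open>K(b)\<close>. Then \<open>t\<close> divides both \<open>n - 2\<close> and \<open>n\<close>,
  hence 2.\<close>

lemma invariant_case:
  assumes t: "card E = card K ^ t" and ST: "card ST = card K ^ (n - 2)"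
  shows "t = 2" "even n" "subalgebra E S R" "ST = S"
proof -
  show "ST = S"
    using card_subset_eq[OF finite_subspace[OF subalgebra_ST] S_subset_ST] card_S ST by simp
  have "card (stable_part b S) = card K ^ (2 * n - 4 - (n - 2))"
    using card_stable_part_S[OF ST] n by simp
  also have "2 * n - 4 - (n - 2) = n - 2" using n by simp
  finally have "stable_part b S = S"
    using card_subset_eq[OF finite_subspace[OF S] stable_part_subset] card_S by metis
  hence "b \<otimes> x \<in> S" if "x \<in> S" for x using that by (auto simp: stable_part_def)
  thus S_E: "subalgebra E S R" using subalgebra_generate_field[OF b(1) S] by blast
  obtain l where l: "n - 2 = t * l" using degree_E_dvd[OF t S_E card_S] .
  obtain N where N: "n = t * N" using degree_E_dvd[OF t carrier_subalgebra_E card_carrier] .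
  have "t dvd n - (n - 2)" using l N by (metis dvd_diff_nat dvd_triv_left)
  hence "t dvd 2" using n by simp
  hence "t \<le> 2" by (simp add: dvd_imp_le)
  thus "t = 2" using degree_E_ge_2[OF t] by simp
  thus "even n" using N by simp
qed

text \<open>The decomposition is applied once more, with base field \<open>K(b)\<close> and a
  \<open>\<gamma>\<close> generating the whole field over it. Over \<open>K(b)\<close> the space
  \<open>S\<close> is a hyperplane, so its stable part under \<open>\<gamma>\<close> has codimension
  exactly 1.\<close>

lemma invariant_case_S:
  assumes t: "card E = card K ^ t" and ST: "card ST = card K ^ (n - 2)"
  obtains c \<gamma> where "c \<in> carrier R - {\<zero>}" "\<gamma> \<in> carrier R - {\<zero>}"
    "generate_field R (insert \<gamma> E) = carrier R"
    "S = c <#\<^bsub>R\<^esub> Span E (map (\<lambda>i. \<gamma> [^] i) [0..<n div 2 - 1])"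
    "independent E (map (\<lambda>i. \<gamma> [^] i) [0..<n div 2 - 1])"
proof -
  note inv = invariant_case[OF t ST]
  interpret L: finite_extension R E
    by (rule finite_extension.intro[OF field_axioms finite_extension_axioms.intro[OF fin subfield_E]])
  define N where "N = n div 2"
  have N: "n = 2 * N" "N \<ge> 3" using inv(2) n by (auto simp: N_def)
  have cE: "card E = card K ^ 2" using t inv(1) by simp
  have cS: "card S = card E ^ (N - 1)"
    unfolding cE card_S N(1) by (simp flip: power_mult add: right_diff_distrib')
  have cR: "card (carrier R) = card E ^ N"
    unfolding cE card_carrier N(1) by (simp flip: power_mult)
  \<comment> \<open>A generator of the cyclic multiplicative group: every nonzero element is a power
    of \<open>\<gamma>\<close>, so it generates the field over any subfield.\<close>
  obtain \<gamma> where g: "\<gamma> \<in> carrier (Multiplicative_Group.mult_of R)"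
      "carrier (Multiplicative_Group.mult_of R) = {\<gamma> [^] i | i::nat. i \<in> UNIV}"
    by (rule bexE[OF finite_field_mult_group_has_gen[OF fin]])
  have gc: "\<gamma> \<in> carrier R" "\<gamma> \<noteq> \<zero>" using g(1) by (auto simp: Multiplicative_Group.carrier_mult_of)
  let ?G = "generate_field R (insert \<gamma> E)"
  have G: "?G = carrier R"
  proof
    show "?G \<subseteq> carrier R" using gc subfieldE(3)[OF subfield_E] by (intro generate_field_incl) auto
    have pow: "\<gamma> [^] i \<in> ?G" for i :: nat
      by (induction i) (auto intro: generate_field.intros)
    show "carrier R \<subseteq> ?G"
    proof
      fix x assume x: "x \<in> carrier R"
      show "x \<in> ?G"
      proof (cases "x = \<zero>")
        case True
        thus ?thesis using zero_in_generate by simp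
      next
        case False
        hence "x \<in> carrier (Multiplicative_Group.mult_of R)"
          using x by (simp add: Multiplicative_Group.carrier_mult_of)
        then obtain i :: nat where "x = \<gamma> [^] i" using g(2) by blast
        thus ?thesis using pow by simp
      qed
    qed
  qed
  have st: "subalgebra E (stable_part \<gamma> S) R" using L.subalgebra_stable_part[OF gc(1) inv(3)]
    by (simp add: L.stable_part_def stable_part_def)
  \<comment> \<open>Otherwise \<open>S\<close> would be a space over the whole field containing
    \<open>\<one>\<close>, hence equal to it.\<close>
  have "stable_part \<gamma> S \<noteq> S"
  proof
    assume "stable_part \<gamma> S = S"
    hence "\<gamma> \<otimes> x \<in> S" if "x \<in> S" for x using that by (auto simp: stable_part_def)
    hence "subalgebra ?G S R" using L.subalgebra_generate_field[OF gc(1) inv(3)] by blast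
    hence "x \<in> S" if "x \<in> carrier R" for x using subalgebraE(4)[of ?G S x \<one>] G one_S that by simp
    hence "S = carrier R" using SD by blast
    hence "n - 2 = n" using card_S card_carrier power_card_K_inject by metis
    thus False using n by simp
  qed
  hence lt: "card (stable_part \<gamma> S) < card S"
    using psubset_card_mono[OF finite_subspace[OF S]] stable_part_subset by (metis psubsetI)
  have "card S * card S = card (S <+>\<^bsub>R\<^esub> (\<gamma> <#\<^bsub>R\<^esub> S)) * card (stable_part \<gamma> S)"
    using card_sum_stable_part[OF gc S] by simp
  also have "\<dots> \<le> card (carrier R) * card (stable_part \<gamma> S)"
    using card_mono[OF fin subalgebraE(1)[OF subalgebra_set_add[OF fin K S subalgebra_l_coset[OF gc(1) S]]]]
    by simp
  \<comment> \<open>This is where \<open>S\<close> being a hyperplane over \<open>K(b)\<close>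
    enters; it bounds the codimension of the stable part by 1.\<close>
  also have "card (carrier R) = card S * card E"
    unfolding cS cR power_Suc2[symmetric] using N(2) by simp
  finally have le: "card S \<le> card E * card (stable_part \<gamma> S)"
    using card_subspace_pos[OF S] by simp
  obtain j where j: "card (stable_part \<gamma> S) = card E ^ j" using L.card_subspace[OF st] by blast
  have E1: "1 < card E" using L.card_K by simp
  have "j < N - 1" using lt E1 unfolding j cS by simp
  moreover have "N - 1 \<le> Suc j"
    using le unfolding j cS power_Suc[symmetric] by (rule power_le_imp_le_exp[OF E1])
  ultimately have "N - 1 = Suc j" by simp
  hence cst: "card S = card E * card (stable_part \<gamma> S)"
    unfolding cS using j by simp
  have cG: "card ?G = card E ^ N" using G cR by simp
  then obtain S' c m where S': "subalgebra ?G S' R" "c \<in> carrier R - {\<zero>}" "1 \<le> m" "m < N"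
    "card S = card S' * card E ^ m" "(c <#\<^bsub>R\<^esub> ?G) \<inter> S' = {\<zero>}"
    "S = S' <+>\<^bsub>R\<^esub> (c <#\<^bsub>R\<^esub> Span E (map (\<lambda>i. \<gamma> [^] i) [0..<m]))"
    using L.almost_stable_decomposition[OF gc inv(3) cst cG] by blast
  have c: "c \<in> carrier R" "c \<noteq> \<zero>" using S'(2) by auto
  \<comment> \<open>The translate \<open>c ?G\<close> is the whole field, so its trivial
    intersection with \<open>S'\<close> forces \<open>S' = {\<zero>}\<close>.\<close>
  have "x \<in> c <#\<^bsub>R\<^esub> ?G" if "x \<in> carrier R" for x
  proof -
    have "c \<in> Units R" using c field_Units by simp
    hence "x = c \<otimes> (inv c \<otimes> x)" "inv c \<otimes> x \<in> carrier R" using that c by (simp_all flip: m_assoc)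
    thus ?thesis unfolding G l_coset_eq_image by blast
  qed
  hence S'0: "S' = {\<zero>}" using S'(6) subalgebraE(1)[OF S'(1)] by blast
  hence "card E ^ (N - 1) = card E ^ m" using S'(5) cS by simp
  hence m: "m = N - 1" using E1 by (simp add: power_inject_exp)
  have "Span E (map (\<lambda>i. \<gamma> [^] i) [0..<m]) \<subseteq> carrier R"
    by (rule Span_in_carrier[OF subfieldE(3)[OF subfield_E] powers_carrier[OF gc(1)]])
  hence "c <#\<^bsub>R\<^esub> Span E (map (\<lambda>i. \<gamma> [^] i) [0..<m]) \<subseteq> carrier R"
    using c(1) m_closed unfolding l_coset_eq_image by blast
  hence "S = c <#\<^bsub>R\<^esub> Span E (map (\<lambda>i. \<gamma> [^] i) [0..<m])"
    using S'(7) unfolding S'0 by (simp only: zero_set_add)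
  moreover have "independent E (map (\<lambda>i. \<gamma> [^] i) [0..<m])"
    using L.independent_powers[OF gc(1) cG] S'(4) by simp
  ultimately show ?thesis using that[OF S'(2) _ G] gc m N_def by simp
qed

end

theorem theorem3p6:
  fixes F :: "('a, 'm) ring_scheme" (structure)
    and K S T ST E :: "'a set" and U :: "('a \<times> 'a) set"
    and a b :: 'a and q n t :: nat
  assumes "field F" and "finite (carrier F)"
    and "subfield K F" and "card K = q" and "card (carrier F) = q ^ n"
    and "n \<ge> 5"
    and "ring.dimension F (n - 2) K S" and "\<one> \<in> S"
    and "a \<in> carrier F - S" and "b \<in> carrier F - K"
    and "U = (S \<times> {\<zero>}) <+>\<^bsub>plane F\<^esub> ring.Span (plane F) (diag K) [(\<one>, \<one>)]
                       <+>\<^bsub>plane F\<^esub> ring.Span (plane F) (diag K) [(a, b)]"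
    and "T = ring.Span F K [\<one>, b]"
    and "ST = span_set F K (S <#> T)"
    and "E = generate_field F (insert b K)" and "card E = q ^ t"
  shows
    "(ring.dimension F n K ST \<or> ring.dimension F (n - 1) K ST \<or> ring.dimension F (n - 2) K ST)
     \<and> \<not> (ring.dimension F n K ST \<and> ring.dimension F (n - 1) K ST)
     \<and> \<not> (ring.dimension F n K ST \<and> ring.dimension F (n - 2) K ST)
     \<and> \<not> (ring.dimension F (n - 1) K ST \<and> ring.dimension F (n - 2) K ST)

     \<and> (ring.dimension F n K ST \<longrightarrow>
          \<not> club F K n (n - 2) U
          \<and> card {P \<in> linear_set F U. weight F K U P = 2} = q ^ (n - 4)
          \<and> int (card (linear_set F U)) = int q ^ (n - 1) + int q ^ (n - 2) - int q ^ (n - 3) + 1)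

     \<and> (ring.dimension F (n - 1) K ST \<longrightarrow>
          (club F K n (n - 2) U \<longleftrightarrow> a \<notin> ST)
          \<and> (a \<in> ST \<longrightarrow>
               card {P \<in> linear_set F U. weight F K U P = 2} = q ^ (n - 3)
               \<and> card (linear_set F U) = q ^ (n - 1) + 1)
          \<and> (a \<notin> ST \<longrightarrow>
               (t \<ge> n - 2 \<longrightarrow>
                  t = n \<and>
                  (\<exists>c \<in> carrier F - {\<zero>}.
                     S = c <#\<^bsub>F\<^esub> ring.Span F K (map (\<lambda>i. b [^] i) [0..<n - 2])
                     \<and> linear_set F U =
                         {proj_point F ((\<Oplus>i \<in> {..n - 3}. c \<otimes> x i \<otimes> b [^] i) \<oplus> \<alpha> \<oplus> \<beta> \<otimes> a,
                                        \<alpha> \<oplus> \<beta> \<otimes> b)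
                          | x \<alpha> \<beta>. x \<in> {..n - 3} \<rightarrow> K \<and> \<alpha> \<in> K \<and> \<beta> \<in> K
                              \<and> \<not> ((\<forall>i \<in> {..n - 3}. x i = \<zero>) \<and> \<alpha> = \<zero> \<and> \<beta> = \<zero>)}))
               \<and> (t \<le> n - 3 \<longrightarrow>
                  t \<ge> 3 \<and>
                  (\<exists>l :: nat. \<exists>c \<in> carrier F - {\<zero>}. \<exists>S'.
                     n = t * (l + 1)
                     \<and> subalgebra E S' F \<and> ring.dimension F l E S'
                     \<and> (c <#\<^bsub>F\<^esub> E) \<inter> S' = {\<zero>}
                     \<and> S = S' <+>\<^bsub>F\<^esub> (c <#\<^bsub>F\<^esub> ring.Span F K (map (\<lambda>i. b [^] i) [0..<t - 2]))
                     \<and> S' \<inter> (c <#\<^bsub>F\<^esub> ring.Span F K (map (\<lambda>i. b [^] i) [0..<t - 2])) = {\<zero>}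
                     \<and> linear_set F U =
                         {proj_point F (s \<oplus> (\<Oplus>i \<in> {..t - 3}. c \<otimes> x i \<otimes> b [^] i) \<oplus> \<alpha> \<oplus> \<beta> \<otimes> a,
                                        \<alpha> \<oplus> \<beta> \<otimes> b)
                          | s x \<alpha> \<beta>. s \<in> S' \<and> x \<in> {..t - 3} \<rightarrow> K \<and> \<alpha> \<in> K \<and> \<beta> \<in> K
                              \<and> \<not> (s = \<zero> \<and> (\<forall>i \<in> {..t - 3}. x i = \<zero>) \<and> \<alpha> = \<zero> \<and> \<beta> = \<zero>)}))))

     \<and> (ring.dimension F (n - 2) K ST \<longrightarrow>
          even n \<and> card E = q ^ 2 \<and> subalgebra E S F
          \<and> (\<exists>c \<in> carrier F - {\<zero>}. \<exists>\<gamma> \<in> carrier F - {\<zero>}.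
               generate_field F (insert \<gamma> E) = carrier F
               \<and> S = c <#\<^bsub>F\<^esub> ring.Span F E (map (\<lambda>i. \<gamma> [^] i) [0..<n div 2 - 1])
               \<and> linear_set F U =
                   {proj_point F ((\<Oplus>i \<in> {..n div 2 - 2}. c \<otimes> x i \<otimes> \<gamma> [^] i) \<oplus> \<alpha> \<oplus> \<beta> \<otimes> a,
                                  \<alpha> \<oplus> \<beta> \<otimes> b)
                    | x \<alpha> \<beta>. x \<in> {..n div 2 - 2} \<rightarrow> E \<and> \<alpha> \<in> K \<and> \<beta> \<in> K
                        \<and> \<not> ((\<forall>i \<in> {..n div 2 - 2}. x i = \<zero>) \<and> \<alpha> = \<zero> \<and> \<beta> = \<zero>)}
               \<and> (club F K n (n - 2) U \<longleftrightarrow>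
                    a \<notin> c <#\<^bsub>F\<^esub> ring.Span F E (map (\<lambda>i. \<gamma> [^] i) [0..<n div 2 - 1]))
               \<and> (a \<in> c <#\<^bsub>F\<^esub> ring.Span F E (map (\<lambda>i. \<gamma> [^] i) [0..<n div 2 - 1]) \<longrightarrow>
                    (\<forall>P \<in> linear_set F U. P \<noteq> proj_point F (\<one>, \<zero>) \<longrightarrow> weight F K U P = 2)
                    \<and> card (linear_set F U) = q ^ (n - 2) + 1)))

     \<and> (Factorial_Ring.prime n \<longrightarrow>
          \<not> (ring.dimension F (n - 1) K ST \<and> a \<notin> ST \<and> t \<le> n - 3)
          \<and> \<not> ring.dimension F (n - 2) K ST)"
proof -
  interpret field F by fact
  have K: "subfield K F" by fact
  have S: "subalgebra K S F" "card S = card K ^ (n - 2)"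
    using dimension_iff_card[OF \<open>finite (carrier F)\<close> K] \<open>ring.dimension F (n - 2) K S\<close> by auto
  interpret C: club_setup F K S a b n
  proof (intro club_setup.intro finite_extension.intro finite_extension_axioms.intro
      club_setup_axioms.intro)
    show "field F" "finite (carrier F)" "subfield K F" "n \<ge> 5" "\<one> \<in> S" by fact+
    show "card (carrier F) = card K ^ n" unfolding assms(4) by fact
    show "subalgebra K S F" "card S = card K ^ (n - 2)" by (fact S)+
    show "a \<in> carrier F" "a \<notin> S" "b \<in> carrier F" "b \<notin> K" using assms(9,10) by blast+
  qed
  have q: "q = card K" using assms(4) by simp
  have U: "U = C.U" unfolding assms(11) by (rule C.U_eq)
  have ST: "ST = C.ST" unfolding assms(13,12) by (rule C.span_set_eq)
  have E: "E = C.E" by (rule assms(14))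
  have t: "card C.E = card K ^ t" unfolding assms(4) assms(14)[symmetric] by (rule assms(15))
  have n: "n \<ge> 5" by fact
  have dim: "dimension k K ST \<longleftrightarrow> card C.ST = card K ^ k" for k
    unfolding ST using dimension_iff_card[OF C.fin K] C.subalgebra_ST by simp
  have club: "club F K n (n - 2) U \<longleftrightarrow> a \<notin> ST"
    unfolding U ST by (rule C.club_iff_not_mem)
  \<comment> \<open>The count is the size of the stable part of \<open>S\<close>;
    \<open>k \<le> n\<close> and \<open>n \<ge> 5\<close> give the required
    \<open>k \<le> 2 * n - 4\<close>.\<close>
  have weight_2: "card {P \<in> linear_set F U. weight F K U P = 2} = q ^ (2 * n - 4 - k)"
    if "a \<in> ST" "dimension k K ST" "k \<le> n" for k
    using C.card_weight_2_eq C.card_stable_part_S[of k] that n dim unfolding U ST q by simp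
  note card_L = C.card_linear_set[folded U q]

  have cases: "(dimension n K ST \<or> dimension (n - 1) K ST \<or> dimension (n - 2) K ST)
     \<and> \<not> (dimension n K ST \<and> dimension (n - 1) K ST)
     \<and> \<not> (dimension n K ST \<and> dimension (n - 2) K ST)
     \<and> \<not> (dimension (n - 1) K ST \<and> dimension (n - 2) K ST)"
  proof -
    have "card K ^ n \<noteq> card K ^ (n - 1)" "card K ^ n \<noteq> card K ^ (n - 2)"
        "card K ^ (n - 1) \<noteq> card K ^ (n - 2)"
      unfolding C.power_card_K_inject using n by linarith+
    thus ?thesis unfolding dim using C.card_ST_cases by argo
  qed

  have case1: "\<not> club F K n (n - 2) U
      \<and> card {P \<in> linear_set F U. weight F K U P = 2} = q ^ (n - 4)
      \<and> int (card (linear_set F U)) = int q ^ (n - 1) + int q ^ (n - 2) - int q ^ (n - 3) + 1"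
    if d: "dimension n K ST"
  proof -
    have "card ST = card (carrier F)" using d dim ST C.card_carrier by simp
    \<comment> \<open>The span is everything, so \<open>a\<close> lies in it automatically.\<close>
    hence "ST = carrier F"
      using card_subset_eq[OF C.fin subalgebraE(1)[OF C.subalgebra_ST]] ST by simp
    hence a: "a \<in> ST" using C.a by simp
    have w: "card {P \<in> linear_set F U. weight F K U P = 2} = q ^ (n - 4)"
      using weight_2[OF a d] n by simp
    moreover have "int q * int (q ^ (n - 4)) = int q ^ Suc (n - 4)" by simp
    moreover have "Suc (n - 4) = n - 3" using n by simp
    ultimately show ?thesis using card_L club a by simp
  qed

  have case2_mem: "card {P \<in> linear_set F U. weight F K U P = 2} = q ^ (n - 3)
      \<and> card (linear_set F U) = q ^ (n - 1) + 1"
    if d: "dimension (n - 1) K ST" and a: "a \<in> ST"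
  proof -
    have "2 * n - 4 - (n - 1) = n - 3" using n by simp
    hence w: "card {P \<in> linear_set F U. weight F K U P = 2} = q ^ (n - 3)"
      using weight_2[OF a d] by simp
    \<comment> \<open>The subtracted term equals \<open>q^(n-2)\<close> and cancels that summand of
      the general count.\<close>
    moreover have "int q * int (q ^ (n - 3)) = int q ^ Suc (n - 3)" by simp
    moreover have "Suc (n - 3) = n - 2" using n by simp
    ultimately have "int (card (linear_set F U)) = int q ^ (n - 1) + 1" using card_L by simp
    hence "int (card (linear_set F U)) = int (q ^ (n - 1) + 1)" by simp
    thus ?thesis using w by linarith
  qed

  have case2: "t \<ge> 3 \<and> (\<exists>l :: nat. \<exists>c \<in> carrier F - {\<zero>}. \<exists>S'.
      n = t * (l + 1)
      \<and> subalgebra E S' F \<and> dimension l E S'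
      \<and> (c <#\<^bsub>F\<^esub> E) \<inter> S' = {\<zero>}
      \<and> S = S' <+>\<^bsub>F\<^esub> (c <#\<^bsub>F\<^esub> Span K (map (\<lambda>i. b [^] i) [0..<t - 2]))
      \<and> S' \<inter> (c <#\<^bsub>F\<^esub> Span K (map (\<lambda>i. b [^] i) [0..<t - 2])) = {\<zero>}
      \<and> linear_set F U =
          {proj_point F (s \<oplus> (\<Oplus>i \<in> {..t - 3}. c \<otimes> x i \<otimes> b [^] i) \<oplus> \<alpha> \<oplus> \<beta> \<otimes> a,
                         \<alpha> \<oplus> \<beta> \<otimes> b)
           | s x \<alpha> \<beta>. s \<in> S' \<and> x \<in> {..t - 3} \<rightarrow> K \<and> \<alpha> \<in> K \<and> \<beta> \<in> K
               \<and> \<not> (s = \<zero> \<and> (\<forall>i \<in> {..t - 3}. x i = \<zero>) \<and> \<alpha> = \<zero> \<and> \<beta> = \<zero>)})"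
    if d: "dimension (n - 1) K ST"
  proof -
    obtain l c S' where S': "t \<ge> 3" "n = t * (l + 1)" "c \<in> carrier F - {\<zero>}" "subalgebra C.E S' F"
        "dimension l C.E S'" "(c <#\<^bsub>F\<^esub> C.E) \<inter> S' = {\<zero>}"
        "S = S' <+>\<^bsub>F\<^esub> (c <#\<^bsub>F\<^esub> Span K (map (\<lambda>i. b [^] i) [0..<t - 2]))"
        "S' \<inter> (c <#\<^bsub>F\<^esub> Span K (map (\<lambda>i. b [^] i) [0..<t - 2])) = {\<zero>}"
      using C.S_decomposition[OF t d[unfolded dim]] by blast
    \<comment> \<open>There are \<open>t - 2\<close> powers, so the last index of the sums is
      \<open>t - 3\<close>; \<open>t \<ge> 3\<close> keeps the subtraction exact.\<close>
    have m: "t - 2 \<ge> 1" "t - 2 - 1 = t - 3" using S'(1) by auto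
    have ind: "independent K (map (\<lambda>i. b [^] i) [0..<t - 2])"
      by (rule C.independent_powers[OF C.b(1) t]) simp
    note lin = C.linear_set_direct_sum[OF m(1) S'(3) ind C.subalgebra_restrict[OF S'(4)] S'(7,8),
        unfolded m(2), folded U]
    show ?thesis
      using S'(1) by (intro conjI exI[of _ l] bexI[OF _ S'(3)] exI[of _ S'] S'(2) S'(7,8) lin)
        (simp_all only: E S')
  qed

  have case2_full: "t = n \<and>
      (\<exists>c \<in> carrier F - {\<zero>}.
         S = c <#\<^bsub>F\<^esub> Span K (map (\<lambda>i. b [^] i) [0..<n - 2])
         \<and> linear_set F U =
             {proj_point F ((\<Oplus>i \<in> {..n - 3}. c \<otimes> x i \<otimes> b [^] i) \<oplus> \<alpha> \<oplus> \<beta> \<otimes> a, \<alpha> \<oplus> \<beta> \<otimes> b)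
              | x \<alpha> \<beta>. x \<in> {..n - 3} \<rightarrow> K \<and> \<alpha> \<in> K \<and> \<beta> \<in> K
                  \<and> \<not> ((\<forall>i \<in> {..n - 3}. x i = \<zero>) \<and> \<alpha> = \<zero> \<and> \<beta> = \<zero>)})"
    if d: "dimension (n - 1) K ST" and tn: "t \<ge> n - 2"
  proof -
    obtain l c S' where S': "t \<ge> 3" "n = t * (l + 1)" "c \<in> carrier F - {\<zero>}" "subalgebra C.E S' F"
        "dimension l C.E S'"
        "S = S' <+>\<^bsub>F\<^esub> (c <#\<^bsub>F\<^esub> Span K (map (\<lambda>i. b [^] i) [0..<t - 2]))"
      using C.S_decomposition[OF t d[unfolded dim]] by blast
    \<comment> \<open>If \<open>l \<ge> 1\<close>, then \<open>n \<ge> 2 t \<ge> 2 n - 4\<close>,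
      which contradicts \<open>n \<ge> 5\<close>.\<close>
    have "l = 0"
    proof (rule ccontr)
      assume "l \<noteq> 0"
      hence "t * 2 \<le> t * (l + 1)" by (intro mult_le_mono2) simp
      hence "t * 2 \<le> n" using S'(2) by linarith
      thus False using tn n by linarith
    qed
    hence tn: "t = n" "S' = {\<zero>}" using S'(2,5) dimension_zero[OF C.subfield_E] by auto
    have c: "c \<in> carrier F" using S'(3) by simp
    have "subalgebra K (c <#\<^bsub>F\<^esub> Span K (map (\<lambda>i. b [^] i) [0..<n - 2])) F"
      using C.subalgebra_l_coset[OF c Span_is_subalgebra[OF K C.powers_carrier[OF C.b(1)]]] .
    hence S_eq: "S = c <#\<^bsub>F\<^esub> Span K (map (\<lambda>i. b [^] i) [0..<n - 2])"
      using S'(6) subalgebraE(1) unfolding tn by (simp only: C.zero_set_add)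
    have m: "n - 2 \<ge> 1" "n - 2 - 1 = n - 3" using n by auto
    have ind: "independent K (map (\<lambda>i. b [^] i) [0..<n - 2])"
      by (rule C.independent_powers[OF C.b(1) t]) (simp add: tn)
    note lin = C.linear_set_full[OF m(1) S'(3) C.b(1) K ind S_eq, unfolded m(2), folded U]
    show ?thesis by (intro conjI bexI[OF _ S'(3)] tn(1) S_eq lin)
  qed

  have case3: "even n \<and> card E = q ^ 2 \<and> subalgebra E S F
      \<and> (\<exists>c \<in> carrier F - {\<zero>}. \<exists>\<gamma> \<in> carrier F - {\<zero>}.
           generate_field F (insert \<gamma> E) = carrier F
           \<and> S = c <#\<^bsub>F\<^esub> Span E (map (\<lambda>i. \<gamma> [^] i) [0..<n div 2 - 1])
           \<and> linear_set F U =
               {proj_point F ((\<Oplus>i \<in> {..n div 2 - 2}. c \<otimes> x i \<otimes> \<gamma> [^] i) \<oplus> \<alpha> \<oplus> \<beta> \<otimes> a,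
                              \<alpha> \<oplus> \<beta> \<otimes> b)
                | x \<alpha> \<beta>. x \<in> {..n div 2 - 2} \<rightarrow> E \<and> \<alpha> \<in> K \<and> \<beta> \<in> K
                    \<and> \<not> ((\<forall>i \<in> {..n div 2 - 2}. x i = \<zero>) \<and> \<alpha> = \<zero> \<and> \<beta> = \<zero>)}
           \<and> (club F K n (n - 2) U \<longleftrightarrow>
                a \<notin> c <#\<^bsub>F\<^esub> Span E (map (\<lambda>i. \<gamma> [^] i) [0..<n div 2 - 1]))
           \<and> (a \<in> c <#\<^bsub>F\<^esub> Span E (map (\<lambda>i. \<gamma> [^] i) [0..<n div 2 - 1]) \<longrightarrow>
                (\<forall>P \<in> linear_set F U. P \<noteq> proj_point F (\<one>, \<zero>) \<longrightarrow> weight F K U P = 2)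
                \<and> card (linear_set F U) = q ^ (n - 2) + 1))"
    if d: "dimension (n - 2) K ST"
  proof -
    note inv = C.invariant_case[OF t d[unfolded dim]]
    obtain c \<gamma> where c: "c \<in> carrier F - {\<zero>}" "\<gamma> \<in> carrier F - {\<zero>}"
        "generate_field F (insert \<gamma> C.E) = carrier F"
        "S = c <#\<^bsub>F\<^esub> Span C.E (map (\<lambda>i. \<gamma> [^] i) [0..<n div 2 - 1])"
        "independent C.E (map (\<lambda>i. \<gamma> [^] i) [0..<n div 2 - 1])"
      using C.invariant_case_S[OF t d[unfolded dim]] by blast
    have m: "n div 2 - 1 \<ge> 1" "n div 2 - 1 - 1 = n div 2 - 2" using n by auto
    have g: "\<gamma> \<in> carrier F" using c(2) by simp
    note lin = C.linear_set_full[OF m(1) c(1) g C.subfield_E c(5,4), unfolded m(2), folded U E]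
    have E2: "even n" "card E = q ^ 2" "subalgebra E S F" using inv t unfolding E q by simp_all
    note S_eq = c(4)[folded E]
    \<comment> \<open>This translate is \<open>S\<close> itself, and \<open>a\<close> lies outside
      \<open>S\<close>. So both sides of the club equivalence are true, and the implication that
      starts from \<open>a\<close> in the translate has a false premise.\<close>
    have a: "a \<notin> c <#\<^bsub>F\<^esub> Span E (map (\<lambda>i. \<gamma> [^] i) [0..<n div 2 - 1])"
      unfolding S_eq[symmetric] by (rule C.a(2))
    have "club F K n (n - 2) U" using club inv(4) C.a(2) ST by simp
    thus ?thesis
      by (intro conjI bexI[OF _ c(1)] bexI[OF _ c(2)] E2 c(3)[folded E] S_eq lin)
        (simp_all only: a simp_thms)
  qed

  have prime: "\<not> (dimension (n - 1) K ST \<and> a \<notin> ST \<and> t \<le> n - 3) \<and> \<not> dimension (n - 2) K ST"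
    if p: "Factorial_Ring.prime n"
  proof (intro conjI notI)
    assume A: "dimension (n - 1) K ST \<and> a \<notin> ST \<and> t \<le> n - 3"
    from case2[OF conjunct1[OF A]] obtain l where "3 \<le> t" "n = t * (l + 1)" by blast
    hence "t dvd n" "t \<le> n - 3" using A by simp_all
    \<comment> \<open>Neither value is compatible with \<open>3 \<le> t \<le> n - 3\<close>.\<close>
    hence "t = 1 \<or> t = n" using p by (simp add: prime_nat_iff)
    thus False using \<open>3 \<le> t\<close> \<open>t \<le> n - 3\<close> n by linarith
  next
    assume "dimension (n - 2) K ST"
    hence "even n" using case3 by blast
    hence "n = 2" using p primes_dvd_imp_eq two_is_prime_nat by blast
    thus False using n by simp
  qed

  show ?thesis
    by (intro conjI impI cases[THEN conjunct1] cases[THEN conjunct2, THEN conjunct1]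
          cases[THEN conjunct2, THEN conjunct2, THEN conjunct1]
          cases[THEN conjunct2, THEN conjunct2, THEN conjunct2] club)
      (simp_all only: case1 case2_mem case2 case2_full case3 prime simp_thms)
qed

end
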